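(* Let $(\mathcal M,g)$ be a closed connected Riemannian manifold of dimension $n\ge3$, let $p\in\{2,3,\dots,n\}$, and let $u\in C^3(\mathcal M)$ satisfy the general $p$-Hessian equation on $\mathcal M$. Assume that there exists a non-negative continuous function $\phi_3$ on $\mathcal M\times\mathbb R$ such that for any $(x,t)\in\mathcal M\times\mathbb R$ and $(\alpha,v)\in T_x^*\mathcal M\times T_x\mathcal M$, $$(A(\alpha,t))(v,v)\le\phi_3(x,t)\,g(v,v)(|\alpha|_g^2+1).$$ If there exists a non-negative constant $C$, depending only on $\mathcal M$, $g$, $n$, $p$, $A(\alpha,t)$, $\varphi(\alpha,t)$ and $\max_{\mathcal M}|u|$, such that $$\lambda\bigl(g^{-1}(A(\mathrm du,u)+\nabla^2u)\bigr)(x)+C\bigl(|\mathrm du(x)|_g^2+1\bigr)\mathbf 1_n\in\overline\Gamma_n,\qquad\forall x\in\mathcal M,$$ then $\max_{\mathcal M}|\mathrm du|_g\le M$, where $M$ is some positive constant depending only on $\mathcal M$, $g$, $n$, $p$, $A(\alpha,t)$, $\varphi(\alpha,t)$ and $\max_{\mathcal M}|u|$.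
   Context: Notation. $\sigma_p(\mu)=\sum_{1\le j_1<\dots<j_p\le n}\mu_{j_1}\cdots\mu_{j_p}$ for $\mu\in\mathbb R^n$; $\Gamma_p=\{\mu\in\mathbb R^n:\sigma_q(\mu)>0\ \forall q\in\{1,\dots,p\}\}$, with closure $\overline\Gamma_p$; $\mathbf 1_n=(1,\dots,1)^T$. "Closed" means compact without boundary. $\pi:T^*\mathcal M\to\mathcal M$ is the projection. $A$ is a smooth map assigning to each $(\alpha,t)\in T^*\mathcal M\times\mathbb R$ a symmetric bilinear form $A(\alpha,t)$ on $T_{\pi(\alpha)}\mathcal M$; $\varphi(\alpha,t)$ is a positive smooth function on $T^*\mathcal M\times\mathbb R$. For $u\in C^2(\mathcal M)$, $\mathrm du$ is its differential, $\nabla^2u$ its Hessian for the Levi-Civita connection, and $A(\mathrm du,u)$ is the tensor field $x\mapsto A(\mathrm du(x),u(x))$. For a symmetric $(0,2)$-tensor field $B$, $\lambda(g^{-1}B)(x)\in\mathbb R^n$ is the vector of eigenvalues, in non-decreasing order, of the matrix product $(g^{jk}(x))(B_{jk}(x))$ in any local coordinates, where $(g^{jk})=(g_{jk})^{-1}$. $|\alpha|_g=(g^{jk}\alpha_j\alpha_k)^{1/2}$ (summation over repeated indices). A constant "depending only on" a list of data can be chosen as a function of these data, uniformly in everything else. The general $p$-Hessian equation for $u\in C^2(\mathcal M)$ is: for all $x\in\mathcal M$, $$\sigma_p^{1/p}\bigl(\lambda(g^{-1}(A(\mathrm du,u)+\nabla^2u))(x)\bigr)=\varphi(\mathrm du(x),u(x)),\qquad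 \lambda(g^{-1}(A(\mathrm du,u)+\nabla^2u))(x)\in\Gamma_p .$$ *)

theory Defs
  imports "HOL-Analysis.Analysis"
begin

section \<open>Elementary symmetric functions and Garding cones\<close>

definition esym :: "nat \<Rightarrow> real^'n \<Rightarrow> real" where
  "esym p \<mu> = (\<Sum>J\<in>{J::'n set. card J = p}. \<Prod>j\<in>J. \<mu> $ j)"

definition Gamma_cone :: "nat \<Rightarrow> (real^'n) set" where
  "Gamma_cone p = {\<mu>. \<forall>q\<in>{1..p}. 0 < esym q \<mu>}"

text \<open>Eigenvalues with algebraic multiplicity, in non-decreasing order along the index type.  The
  description is meaningful only when the characteristic polynomial splits over the reals, as it
  does for \<open>g\<^sup>-\<^sup>1 B\<close> with \<open>g\<close> positive definite and \<open>B\<close> symmetric.\<close>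

definition sorted_eigenvalues :: "real^('n::{finite,linorder})^('n::{finite,linorder}) \<Rightarrow>
     real^('n::{finite,linorder})" where
  "sorted_eigenvalues P = (THE \<mu>. (\<forall>i j. i \<le> j \<longrightarrow> \<mu> $ i \<le> \<mu> $ j) \<and>
     (\<forall>t. det (mat t - P) = (\<Prod>i\<in>UNIV. (t - \<mu> $ i))))"


section \<open>Maps of class \<open>C\<^sup>k\<close> between Euclidean spaces\<close>

text \<open>Only used for open sets \<open>S\<close>.\<close>

primrec Ck_on :: "nat \<Rightarrow> ('a::euclidean_space \<Rightarrow> 'b::euclidean_space) \<Rightarrow> 'a set \<Rightarrow> bool" where
  "Ck_on 0 f S \<longleftrightarrow> continuous_on S f"
| "Ck_on (Suc k) f S \<longleftrightarrow> (\<forall>x\<in>S. f differentiable (at x)) \<and>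
     (\<forall>v. Ck_on k (\<lambda>x. frechet_derivative f (at x) v) S)"

definition smooth_on :: "('a::euclidean_space \<Rightarrow> 'b::euclidean_space) \<Rightarrow> 'a set \<Rightarrow> bool" where
  "smooth_on f S \<longleftrightarrow> (\<forall>k. Ck_on k f S)"

definition pderiv_at :: "'n \<Rightarrow> (real^'n \<Rightarrow> real) \<Rightarrow> real^'n \<Rightarrow> real" where
  "pderiv_at i f y = frechet_derivative f (at y) (axis i 1)"


section \<open>Smooth manifolds\<close>

text \<open>A chart is a pair of its domain and its coordinate map, whose values outside the domain are
  irrelevant.\<close>

type_synonym ('m, 'n) chart = "'m set \<times> ('m \<Rightarrow> real^'n)"

definition chart_image :: "('m, 'n) chart \<Rightarrow> (real^'n) set" where
  "chart_image c = snd c ` fst c"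

definition chart_inv :: "('m, 'n) chart \<Rightarrow> real^'n \<Rightarrow> 'm" where
  "chart_inv c = inv_into (fst c) (snd c)"

text \<open>The atlas need not be maximal.  The images of charts are open in \<open>\<real>\<^sup>n\<close>, so there is no
  boundary.\<close>

definition smooth_manifold :: "'m topology \<Rightarrow> ('m, 'n::finite) chart set \<Rightarrow> bool" where
  "smooth_manifold X \<A> \<longleftrightarrow> Hausdorff_space X \<and> second_countable X \<and>
     (\<Union>c\<in>\<A>. fst c) = topspace X \<and>
     (\<forall>c\<in>\<A>. openin X (fst c) \<and> open (chart_image c) \<and>
        homeomorphic_map (subtopology X (fst c)) (top_of_set (chart_image c)) (snd c)) \<and>
     (\<forall>c\<in>\<A>. \<forall>d\<in>\<A>. smooth_on (snd d \<circ> chart_inv c) (snd c ` (fst c \<inter> fst d)))"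

definition charts_at :: "('m, 'n) chart set \<Rightarrow> 'm \<Rightarrow> ('m, 'n) chart set" where
  "charts_at \<A> x = {c \<in> \<A>. x \<in> fst c}"

text \<open>Used to evaluate expressions that do not depend on the choice of a chart around the point.\<close>

definition chart_at :: "('m, 'n) chart set \<Rightarrow> 'm \<Rightarrow> ('m, 'n) chart" where
  "chart_at \<A> x = (SOME c. c \<in> charts_at \<A> x)"

definition Ck_manifold :: "('m, 'n::finite) chart set \<Rightarrow> nat \<Rightarrow> ('m \<Rightarrow> real) \<Rightarrow> bool" where
  "Ck_manifold \<A> k u \<longleftrightarrow> (\<forall>c\<in>\<A>. Ck_on k (u \<circ> chart_inv c) (chart_image c))"


section \<open>Tangent and cotangent spaces\<close>

text \<open>A tangent vector at \<open>x\<close> assigns to each chart around \<open>x\<close> its component vector, and the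
  components in two charts are related by the Jacobian of the coordinate change.  The value
  \<open>0\<close> at all other charts only makes the representation unique.  The vector space operations are
  pointwise.\<close>

type_synonym ('m, 'n) tvec = "('m, 'n) chart \<Rightarrow> real^'n"

definition tangent_space :: "('m, 'n::finite) chart set \<Rightarrow> 'm \<Rightarrow> ('m, 'n) tvec set" where
  "tangent_space \<A> x = {v. (\<forall>c. c \<notin> charts_at \<A> x \<longrightarrow> v c = 0) \<and>
     (\<forall>c\<in>charts_at \<A> x. \<forall>d\<in>charts_at \<A> x.
        v d = frechet_derivative (snd d \<circ> chart_inv c) (at (snd c x)) (v c))}"

text \<open>The coordinate vector field \<open>\<partial>/\<partial>y\<^sub>i\<close> of the chart \<open>c\<close>, at the point \<open>x\<close>.\<close>

definition coord_vec :: "('m, 'n::finite) chart set \<Rightarrow> ('m, 'n) chart \<Rightarrow> 'm \<Rightarrow> 'n \<Rightarrow> ('m, 'n) tvec"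
  where
  "coord_vec \<A> c x i = (\<lambda>d. if d \<in> charts_at \<A> x
     then frechet_derivative (snd d \<circ> chart_inv c) (at (snd c x)) (axis i 1) else 0)"

definition tangent_linear :: "('m, 'n::finite) chart set \<Rightarrow> 'm \<Rightarrow> (('m, 'n) tvec \<Rightarrow> real) \<Rightarrow> bool" where
  "tangent_linear \<A> x f \<longleftrightarrow> (\<forall>v\<in>tangent_space \<A> x. \<forall>w\<in>tangent_space \<A> x. \<forall>a b.
     f (\<lambda>c. a *\<^sub>R v c + b *\<^sub>R w c) = a * f v + b * f w)"

text \<open>Covectors are linear functionals on the tangent space; \<open>extensional\<close> fixes their irrelevant
  values elsewhere.  Elements of the cotangent bundle are paired with their base point, so that
  \<open>fst\<close> is the projection to the manifold.\<close>

type_synonym ('m, 'n) covec = "'m \<times> (('m, 'n) tvec \<Rightarrow> real)"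

definition cotangent_space :: "('m, 'n::finite) chart set \<Rightarrow> 'm \<Rightarrow> ('m, 'n) covec set" where
  "cotangent_space \<A> x = {x} \<times> {\<xi> \<in> extensional (tangent_space \<A> x). tangent_linear \<A> x \<xi>}"

definition cotangent_bundle ::
  "'m topology \<Rightarrow> ('m, 'n::finite) chart set \<Rightarrow> ('m, 'n) covec set" where
  "cotangent_bundle X \<A> = (\<Union>x\<in>topspace X. cotangent_space \<A> x)"

text \<open>The covector \<open>\<Sum>\<^sub>i \<xi>\<^sub>i dy\<^sub>i\<close> at the point with coordinates \<open>y\<close> in the chart \<open>c\<close>; this is the
  inverse of the bundle chart of the cotangent bundle induced by \<open>c\<close>.\<close>

definition coord_covec ::
  "('m, 'n::finite) chart set \<Rightarrow> ('m, 'n) chart \<Rightarrow> real^'n \<Rightarrow> real^'n \<Rightarrow> ('m, 'n) covec" where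
  "coord_covec \<A> c y \<xi> =
     (chart_inv c y, \<lambda>v\<in>tangent_space \<A> (chart_inv c y). \<xi> \<bullet> v c)"

definition symmetric_bilinear ::
  "('m, 'n::finite) chart set \<Rightarrow> 'm \<Rightarrow> (('m, 'n) tvec \<Rightarrow> ('m, 'n) tvec \<Rightarrow> real) \<Rightarrow> bool" where
  "symmetric_bilinear \<A> x B \<longleftrightarrow>
     (\<forall>v\<in>tangent_space \<A> x. \<forall>w\<in>tangent_space \<A> x. B v w = B w v) \<and>
     (\<forall>w\<in>tangent_space \<A> x. tangent_linear \<A> x (\<lambda>v. B v w))"

definition tensor_matrix ::
  "('m, 'n::finite) chart set \<Rightarrow> ('m, 'n) chart \<Rightarrow> 'm \<Rightarrow>
     (('m, 'n) tvec \<Rightarrow> ('m, 'n) tvec \<Rightarrow> real) \<Rightarrow> real^'n^'n" where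
  "tensor_matrix \<A> c x B = (\<chi> i j. B (coord_vec \<A> c x i) (coord_vec \<A> c x j))"


section \<open>Functions and bilinear forms depending on a covector and a real number\<close>

text \<open>Smoothness on \<open>T\<^sup>*M \<times> \<real>\<close>, in the coordinates \<open>(y, \<xi>, t)\<close> induced by the charts.\<close>

definition smooth_scalar ::
  "('m, 'n::finite) chart set \<Rightarrow> (('m, 'n) covec \<Rightarrow> real \<Rightarrow> real) \<Rightarrow> bool" where
  "smooth_scalar \<A> f \<longleftrightarrow> (\<forall>c\<in>\<A>.
     smooth_on (\<lambda>(y, \<xi>, t). f (coord_covec \<A> c y \<xi>) t) (chart_image c \<times> UNIV \<times> UNIV))"

definition smooth_bilinear_family ::
  "'m topology \<Rightarrow> ('m, 'n::finite) chart set \<Rightarrow>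
     (('m, 'n) covec \<Rightarrow> real \<Rightarrow> ('m, 'n) tvec \<Rightarrow> ('m, 'n) tvec \<Rightarrow> real) \<Rightarrow> bool" where
  "smooth_bilinear_family X \<A> A \<longleftrightarrow>
     (\<forall>\<alpha>\<in>cotangent_bundle X \<A>. \<forall>t. symmetric_bilinear \<A> (fst \<alpha>) (A \<alpha> t)) \<and>
     (\<forall>c\<in>\<A>. \<forall>i j.
        smooth_on (\<lambda>(y, \<xi>, t). tensor_matrix \<A> c (chart_inv c y) (A (coord_covec \<A> c y \<xi>) t) $ i $ j)
          (chart_image c \<times> UNIV \<times> UNIV))"


section \<open>Riemannian metrics\<close>

type_synonym ('m, 'n) metric = "'m \<Rightarrow> ('m, 'n) tvec \<Rightarrow> ('m, 'n) tvec \<Rightarrow> real"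

definition metric_matrix ::
  "('m, 'n::finite) chart set \<Rightarrow> ('m, 'n) metric \<Rightarrow> ('m, 'n) chart \<Rightarrow> real^'n \<Rightarrow> real^'n^'n" where
  "metric_matrix \<A> g c y = tensor_matrix \<A> c (chart_inv c y) (g (chart_inv c y))"

definition riemannian_metric ::
  "'m topology \<Rightarrow> ('m, 'n::finite) chart set \<Rightarrow> ('m, 'n) metric \<Rightarrow> bool" where
  "riemannian_metric X \<A> g \<longleftrightarrow>
     (\<forall>x\<in>topspace X. symmetric_bilinear \<A> x (g x) \<and>
        (\<forall>v\<in>tangent_space \<A> x. v \<noteq> (\<lambda>_. 0) \<longrightarrow> 0 < g x v v)) \<and>
     (\<forall>c\<in>\<A>. \<forall>i j. smooth_on (\<lambda>y. metric_matrix \<A> g c y $ i $ j) (chart_image c))"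

definition covec_norm :: "('m, 'n::finite) chart set \<Rightarrow> ('m, 'n) metric \<Rightarrow> ('m, 'n) covec \<Rightarrow> real" where
  "covec_norm \<A> g \<alpha> =
     (let x = fst \<alpha>; c = chart_at \<A> x; G = matrix_inv (metric_matrix \<A> g c (snd c x));
          a = (\<lambda>i. snd \<alpha> (coord_vec \<A> c x i))
      in sqrt (\<Sum>j\<in>UNIV. \<Sum>k\<in>UNIV. G $ j $ k * a j * a k))"

definition differential :: "('m, 'n::finite) chart set \<Rightarrow> ('m \<Rightarrow> real) \<Rightarrow> 'm \<Rightarrow> ('m, 'n) covec" where
  "differential \<A> u x = (let c = chart_at \<A> x in
     (x, \<lambda>v\<in>tangent_space \<A> x. frechet_derivative (u \<circ> chart_inv c) (at (snd c x)) (v c)))"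

text \<open>The Christoffel symbol \<open>\<Gamma>\<^sup>k\<^sub>i\<^sub>j\<close> of the Levi-Civita connection in the chart \<open>c\<close>, at the
  coordinates \<open>y\<close>.\<close>

definition christoffel ::
  "('m, 'n::finite) chart set \<Rightarrow> ('m, 'n) metric \<Rightarrow> ('m, 'n) chart \<Rightarrow> real^'n \<Rightarrow> 'n \<Rightarrow> 'n \<Rightarrow> 'n \<Rightarrow> real"
  where
  "christoffel \<A> g c y k i j = (\<Sum>l\<in>UNIV. matrix_inv (metric_matrix \<A> g c y) $ k $ l *
     (pderiv_at i (\<lambda>z. metric_matrix \<A> g c z $ j $ l) y
      + pderiv_at j (\<lambda>z. metric_matrix \<A> g c z $ i $ l) y
      - pderiv_at l (\<lambda>z. metric_matrix \<A> g c z $ i $ j) y)) / 2"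

text \<open>\<open>\<nabla>\<^sup>2u = \<nabla>(du)\<close>, in components \<open>\<partial>\<^sub>i\<partial>\<^sub>ju - \<Gamma>\<^sup>k\<^sub>i\<^sub>j\<partial>\<^sub>ku\<close>.\<close>

definition hessian ::
  "('m, 'n::finite) chart set \<Rightarrow> ('m, 'n) metric \<Rightarrow> ('m \<Rightarrow> real) \<Rightarrow> 'm \<Rightarrow>
     ('m, 'n) tvec \<Rightarrow> ('m, 'n) tvec \<Rightarrow> real" where
  "hessian \<A> g u x v w =
     (let c = chart_at \<A> x; y = snd c x; f = u \<circ> chart_inv c
      in \<Sum>i\<in>UNIV. \<Sum>j\<in>UNIV.
           (pderiv_at i (pderiv_at j f) y
            - (\<Sum>k\<in>UNIV. christoffel \<A> g c y k i j * pderiv_at k f y)) * v c $ i * w c $ j)"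

text \<open>The vector \<open>\<lambda>(g\<^sup>-\<^sup>1 B)(x)\<close>.\<close>

definition metric_eigenvalues ::
  "('m, 'n::{finite,linorder}) chart set \<Rightarrow> ('m, 'n) metric \<Rightarrow> 'm \<Rightarrow>
     (('m, 'n) tvec \<Rightarrow> ('m, 'n) tvec \<Rightarrow> real) \<Rightarrow> real^('n::{finite,linorder})" where
  "metric_eigenvalues \<A> g x B = (let c = chart_at \<A> x in
     sorted_eigenvalues (matrix_inv (metric_matrix \<A> g c (snd c x)) ** tensor_matrix \<A> c x B))"


section \<open>The general \<open>p\<close>-Hessian equation\<close>

text \<open>The vector \<open>\<lambda>(g\<^sup>-\<^sup>1(A(du,u) + \<nabla>\<^sup>2u))(x)\<close>.\<close>

definition hessian_eigenvalues ::
  "('m, 'n::{finite,linorder}) chart set \<Rightarrow> ('m, 'n) metric \<Rightarrow>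
     (('m, 'n) covec \<Rightarrow> real \<Rightarrow> ('m, 'n) tvec \<Rightarrow> ('m, 'n) tvec \<Rightarrow> real) \<Rightarrow>
     ('m \<Rightarrow> real) \<Rightarrow> 'm \<Rightarrow> real^('n::{finite,linorder})" where
  "hessian_eigenvalues \<A> g A u x = metric_eigenvalues \<A> g x
     (\<lambda>v w. A (differential \<A> u x) (u x) v w + hessian \<A> g u x v w)"

definition general_p_hessian_equation ::
  "'m topology \<Rightarrow> ('m, 'n::{finite,linorder}) chart set \<Rightarrow> ('m, 'n) metric \<Rightarrow> nat \<Rightarrow>
     (('m, 'n) covec \<Rightarrow> real \<Rightarrow> ('m, 'n) tvec \<Rightarrow> ('m, 'n) tvec \<Rightarrow> real) \<Rightarrow>
     (('m, 'n) covec \<Rightarrow> real \<Rightarrow> real) \<Rightarrow> ('m \<Rightarrow> real) \<Rightarrow> bool" where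
  "general_p_hessian_equation X \<A> g p A \<phi> u \<longleftrightarrow> (\<forall>x\<in>topspace X.
     root p (esym p (hessian_eigenvalues \<A> g A u x)) = \<phi> (differential \<A> u x) (u x) \<and>
     hessian_eigenvalues \<A> g A u x \<in> Gamma_cone p)"

text \<open>On a nonempty compact space the supremum of a continuous function is its maximum.\<close>

definition max_over :: "'m topology \<Rightarrow> ('m \<Rightarrow> real) \<Rightarrow> real" where
  "max_over X f = (SUP x\<in>topspace X. f x)"

end

theory Submission
  imports Defs "HOL-Computational_Algebra.Polynomial"
begin

text \<open>The estimate is a maximum principle for the function \<open>(1 + |du|\<^sup>2) exp (2 \<beta> u)\<close> with a large
  constant \<open>\<beta>\<close>.

  Membership in the closure of the cone \<open>\<Gamma>\<^sub>n\<close> says that all coordinates are non-negative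
  (\<open>closure_Gamma_cone_nonneg\<close>).  Hence the hypothesis on the eigenvalues is the inequality
  \<open>A(du,u) + \<nabla>\<^sup>2u \<ge> - C (|du|\<^sup>2 + 1) g\<close> of quadratic forms
  (\<open>hessian_lower_bound_of_eigenvalues\<close>).  On the compact set of all \<open>(x, t)\<close> with
  \<open>|t| \<le> K = max |u|\<close> the function \<open>\<phi>3\<close> is bounded, so the growth condition on \<open>A\<close> turns this into
  \<open>\<nabla>\<^sup>2u \<ge> - B (|du|\<^sup>2 + 1) g\<close>, where \<open>B\<close> depends only on the data and on \<open>K\<close>.

  At a maximum point of \<open>(1 + |du|\<^sup>2) exp (2 \<beta> u)\<close> its derivative in the direction of the gradient
  \<open>V\<close> of \<open>u\<close> vanishes.  As \<open>d(|du|\<^sup>2)(V) = 2 \<nabla>\<^sup>2u(V,V)\<close> and \<open>du(V) = |du|\<^sup>2\<close>, this says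
  \<open>\<nabla>\<^sup>2u(V,V) = - \<beta> (1 + |du|\<^sup>2) |du|\<^sup>2\<close>, and for \<open>\<beta> > B\<close> that contradicts the lower bound unless
  \<open>du = 0\<close> at this point (\<open>gradient_vanishes_at_maximum\<close>).  Therefore the maximum is at most
  \<open>exp (2 \<beta> K)\<close>, and everywhere \<open>1 + |du|\<^sup>2 \<le> exp (4 \<beta> K)\<close>
  (\<open>gradient_bound_of_hessian_bound\<close>).

  The remaining work is to make these notions available in coordinates: the ordered eigenvalues
  exist and are unique because a positive definite form and a symmetric form can be diagonalised
  together; the Hessian is symmetric because second derivatives commute; and \<open>|du|\<close>, defined
  through one chosen chart at each point, is computed by the same formula in every chart and is
  therefore continuous (\<open>covec_norm_sq\<close>).\<close>


section \<open>The smallest Garding cone\<close>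

lemma prod_add_eq_esym_sum:
  fixes \<mu> :: "real^'n"
  shows "(\<Prod>i\<in>UNIV. \<mu> $ i + t) = (\<Sum>k\<le>CARD('n). esym k \<mu> * t ^ (CARD('n) - k))"
proof -
  have "(\<Prod>i\<in>UNIV. \<mu> $ i + t) = (\<Sum>J\<in>Pow UNIV. (\<Prod>j\<in>J. \<mu> $ j) * (\<Prod>j\<in>UNIV - J. t))"
    by (rule prod_add) simp
  also have "\<dots> = (\<Sum>J\<in>(UNIV::'n set set). (\<Prod>j\<in>J. \<mu> $ j) * t ^ (CARD('n) - card J))"
    by (simp add: card_Diff_subset)
  also have "\<dots> = (\<Sum>k\<in>{..CARD('n)}. \<Sum>J\<in>{J \<in> (UNIV::'n set set). card J = k}. (\<Prod>j\<in>J. \<mu> $ j) * t ^ (CARD('n) - card J))"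
    by (rule sum.group [symmetric]) (auto intro: card_mono)
  also have "\<dots> = (\<Sum>k\<le>CARD('n). esym k \<mu> * t ^ (CARD('n) - k))"
    by (simp add: esym_def sum_distrib_right)
  finally show ?thesis .
qed

text \<open>The polynomial \<open>\<Prod>\<^sub>i (\<mu>\<^sub>i + t)\<close> has the elementary symmetric functions of \<open>\<mu>\<close> as its
  coefficients.  On the smallest Garding cone they are all positive, so that no \<open>t \<ge> 0\<close> is a root;
  but \<open>- \<mu>\<^sub>i\<close> is a root.\<close>

lemma Gamma_cone_pos:
  fixes \<mu> :: "real^'n"
  assumes "\<mu> \<in> Gamma_cone CARD('n)"
  shows "0 < \<mu> $ i"
proof (rule ccontr)
  assume neg: "\<not> 0 < \<mu> $ i"
  define t where "t = - \<mu> $ i"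
  have "t \<ge> 0" using neg by (simp add: t_def)
  have pos: "0 < esym k \<mu>" if "1 \<le> k" "k \<le> CARD('n)" for k
    using assms that by (auto simp: Gamma_cone_def)
  have "esym 0 \<mu> = 1"
    by (simp add: esym_def)
  then have nonneg: "0 \<le> esym k \<mu>" if "k \<le> CARD('n)" for k
    using pos[of k] that by (cases "k = 0") auto
  have "0 < (\<Sum>k\<le>CARD('n). esym k \<mu> * t ^ (CARD('n) - k))"
  proof (rule sum_pos2)
    show "0 < esym CARD('n) \<mu> * t ^ (CARD('n) - CARD('n))"
      using pos[of "CARD('n)"] by (simp add: Suc_leI)
  qed (use nonneg \<open>t \<ge> 0\<close> in auto)
  also have "\<dots> = (\<Prod>i\<in>UNIV. \<mu> $ i + t)"
    by (rule prod_add_eq_esym_sum [symmetric])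
  also have "\<dots> = 0"
    by (rule prod_zero) (auto simp: t_def)
  finally show False by simp
qed

lemma closure_Gamma_cone_nonneg:
  fixes \<mu> :: "real^'n"
  assumes "\<mu> \<in> closure (Gamma_cone CARD('n))"
  shows "0 \<le> \<mu> $ i"
proof -
  have "closed {\<mu> :: real^'n. 0 \<le> \<mu> $ i}"
    by (intro closed_Collect_le continuous_intros)
  moreover have "Gamma_cone CARD('n) \<subseteq> {\<mu> :: real^'n. 0 \<le> \<mu> $ i}"
  proof
    fix \<nu> :: "real^'n" assume "\<nu> \<in> Gamma_cone CARD('n)"
    from Gamma_cone_pos[OF this, of i] show "\<nu> \<in> {\<mu>. 0 \<le> \<mu> $ i}" by simp
  qed
  ultimately show ?thesis
    using assms closure_minimal by (metis mem_Collect_eq subsetD)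
qed

section \<open>Eigenvalues of a symmetric form relative to a metric\<close>

text \<open>Let \<open>b\<close> maximise the Rayleigh quotient \<open>w x x / g x x\<close> on \<open>S\<close>.  The first-order condition at \<open>b\<close> is
  \<open>w b y = m * g b y\<close> for all \<open>y \<in> S\<close>, hence the \<open>g\<close>-orthogonal complement of \<open>b\<close> in \<open>S\<close> is also
  \<open>w\<close>-orthogonal to \<open>b\<close>, and induction on the dimension applies to it.  Working with two bilinear
  forms, rather than with a self-adjoint operator, diagonalises both by one induction and avoids a
  square root of \<open>g\<close>.\<close>

lemma simultaneous_orthogonal_basis:
  fixes g w :: "'a::euclidean_space \<Rightarrow> 'a \<Rightarrow> real"
  assumes g: "bilinear g" "\<And>x y. g x y = g y x" "\<And>x. x \<noteq> 0 \<Longrightarrow> 0 < g x x"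
    and w: "bilinear w" "\<And>x y. w x y = w y x"
    and "subspace S"
  shows "\<exists>B\<subseteq>S. span B = S \<and> (\<forall>x\<in>B. \<forall>y\<in>B. g x y = (if x = y then 1 else 0)) \<and>
           (\<forall>x\<in>B. \<forall>y\<in>B. x \<noteq> y \<longrightarrow> w x y = 0)"
  using \<open>subspace S\<close>
proof (induction "dim S" arbitrary: S rule: less_induct)
  case less
  note bil = bilinear_ladd bilinear_radd bilinear_lmul bilinear_rmul
  show ?case
  proof (cases "S \<subseteq> {0}")
    case True
    then have "S = {0}" using less.prems subspace_0 by blast
    then show ?thesis by (intro exI[of _ "{}"]) auto
  next
    case False
    have bg: "bounded_bilinear g" and bw: "bounded_bilinear w"
      using g(1) w(1) by (simp_all add: bilinear_conv_bounded_bilinear)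
    have cpt: "compact (sphere 0 1 \<inter> S)"
      using less.prems by (intro compact_Int_closed closed_subspace) auto
    have ne: "sphere 0 1 \<inter> S \<noteq> {}"
    proof -
      obtain x where "x \<in> S" "x \<noteq> 0" using False by auto
      then have "(1 / norm x) *\<^sub>R x \<in> sphere 0 1 \<inter> S"
        using less.prems by (auto simp: subspace_scale)
      then show ?thesis by blast
    qed
    have "g x x \<noteq> 0" if "norm x = 1" for x
      using g(3)[of x] that by (cases "x = 0") auto
    then have cont: "continuous_on (sphere 0 1 \<inter> S) (\<lambda>x. w x x / g x x)"
      by (intro continuous_intros bounded_bilinear.continuous_on[OF bg] bounded_bilinear.continuous_on[OF bw])
        auto
    obtain a where a: "a \<in> sphere 0 1 \<inter> S"
      and amax: "\<And>x. x \<in> sphere 0 1 \<inter> S \<Longrightarrow> w x x / g x x \<le> w a a / g a a"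
      using continuous_attains_sup[OF cpt ne cont] by blast
    define m where "m = w a a / g a a"
    have "a \<noteq> 0" "a \<in> S" using a by auto
    have gaa: "0 < g a a" by (rule g(3)) fact
    define b where "b = (1 / sqrt (g a a)) *\<^sub>R a"
    have "b \<in> S" using \<open>a \<in> S\<close> less.prems by (simp add: b_def subspace_scale)
    have "g b b = (1 / sqrt (g a a)) * ((1 / sqrt (g a a)) * g a a)"
      by (simp only: b_def bilinear_lmul[OF g(1)] bilinear_rmul[OF g(1)] real_scaleR_def)
    also have "\<dots> = 1" using gaa by (simp add: field_simps)
    finally have gbb: "g b b = 1" .
    have "w b b = (1 / sqrt (g a a)) * ((1 / sqrt (g a a)) * w a a)"
      by (simp only: b_def bilinear_lmul[OF w(1)] bilinear_rmul[OF w(1)] real_scaleR_def)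
    also have "\<dots> = m" using gaa by (simp add: field_simps m_def)
    finally have wbb: "w b b = m" .
    have le: "w x x \<le> m * g x x" if "x \<in> S" for x
    proof (cases "x = 0")
      case True
      then show ?thesis using bilinear_lzero[OF g(1)] bilinear_lzero[OF w(1)] by simp
    next
      case False
      have "(1 / norm x) *\<^sub>R x \<in> sphere 0 1 \<inter> S"
        using less.prems False that by (auto simp: subspace_scale)
      from amax[OF this] have "w x x / g x x \<le> m"
        using False by (simp add: m_def bilinear_lmul[OF g(1)] bilinear_rmul[OF g(1)]
            bilinear_lmul[OF w(1)] bilinear_rmul[OF w(1)] divide_simps split: if_splits)
      then show ?thesis using g(3)[OF False] by (simp add: field_simps)
    qed
    \<comment> \<open>The first-order condition at the maximum of the Rayleigh quotient.\<close>
    have crit: "w b y = m * g b y" if "y \<in> S" for y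
    proof (rule ccontr)
      define r where "r = w b y - m * g b y"
      define q where "q = m * g y y - w y y"
      assume "w b y \<noteq> m * g b y"
      then have "r \<noteq> 0" by (simp add: r_def)
      have "q \<ge> 0" using le[OF that] by (simp add: q_def)
      \<comment> \<open>Moving from \<open>b\<close> to \<open>b + t y\<close> gives \<open>2 t r \<le> t\<^sup>2 q\<close>; with this \<open>t\<close> the linear term wins.\<close>
      define t where "t = r / (q + 1)"
      have "b + t *\<^sub>R y \<in> S" using \<open>b \<in> S\<close> that less.prems by (simp add: subspace_add subspace_scale)
      from le[OF this] have "m + t * w b y + (t * w b y + t * (t * w y y)) \<le>
          m * (1 + t * g b y + (t * g b y + t * (t * g y y)))"
        using gbb wbb g(2)[of y b] w(2)[of y b]
        by (simp add: bilinear_ladd[OF g(1)] bilinear_radd[OF g(1)] bilinear_ladd[OF w(1)] bilinear_radd[OF w(1)]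
            bilinear_lmul[OF g(1)] bilinear_rmul[OF g(1)] bilinear_lmul[OF w(1)] bilinear_rmul[OF w(1)] algebra_simps)
      then have "2 * t * r \<le> t * (t * q)"
        by (simp add: r_def q_def algebra_simps)
      moreover have "t * (q + 1) = r" using \<open>q \<ge> 0\<close> by (simp add: t_def)
      ultimately have "2 * t * (t * (q + 1)) \<le> t * (t * q)" by simp
      then have "(t * t) * (q + 2) \<le> 0" by (simp add: algebra_simps)
      moreover have "t \<noteq> 0" using \<open>r \<noteq> 0\<close> \<open>q \<ge> 0\<close> by (simp add: t_def)
      then have "0 < t * t" by (metis not_real_square_gt_zero)
      then have "0 < (t * t) * (q + 2)"
        by (rule mult_pos_pos) (use \<open>q \<ge> 0\<close> in simp)
      ultimately show False by simp
    qed
    define S' where "S' = {x \<in> S. g b x = 0}"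
    have S': "subspace S'"
      using less.prems by (auto simp: S'_def subspace_def bilinear_radd[OF g(1)] bilinear_rmul[OF g(1)]
          bilinear_rzero[OF g(1)])
    have "b \<notin> S'" using gbb by (simp add: S'_def)
    then have "S' \<subset> S" using \<open>b \<in> S\<close> by (auto simp: S'_def)
    moreover have "span S' = S'" "span S = S" using less.prems S' by simp_all
    ultimately have "dim S' < dim S" using dim_psubset[of S' S] by metis
    from less.hyps[OF this S'] obtain B where B: "B \<subseteq> S'" and spanB: "span B = S'"
      and B': "\<forall>x\<in>B. \<forall>y\<in>B. g x y = (if x = y then 1 else 0)"
      "\<forall>x\<in>B. \<forall>y\<in>B. x \<noteq> y \<longrightarrow> w x y = 0"
      by (elim exE conjE) (rule that; assumption)
    have sub: "insert b B \<subseteq> S" using \<open>b \<in> S\<close> \<open>S' \<subset> S\<close> B(1) by auto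
    have "S \<subseteq> span (insert b B)"
    proof
      fix x assume "x \<in> S"
      have "g b (x - g b x *\<^sub>R b) = 0"
        using gbb by (simp add: bilinear_rsub[OF g(1)] bilinear_rmul[OF g(1)])
      then have "x - g b x *\<^sub>R b \<in> S'"
        using \<open>x \<in> S\<close> \<open>b \<in> S\<close> less.prems by (simp add: S'_def subspace_diff subspace_scale)
      then show "x \<in> span (insert b B)" using spanB span_breakdown_eq[of x b B] by blast
    qed
    then have "span (insert b B) = S"
      using sub less.prems span_minimal by blast
    moreover have gb: "g b x = 0" "g x b = 0" and wb: "w b x = 0" "w x b = 0" if "x \<in> B" for x
    proof -
      have "x \<in> S'" using that B(1) by auto
      then show "g b x = 0" "w b x = 0" using crit[of x] by (auto simp: S'_def)
      then show "g x b = 0" "w x b = 0" using g(2) w(2) by metis+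
    qed
    moreover have "b \<notin> B" using \<open>b \<notin> S'\<close> B(1) by auto
    ultimately show ?thesis
      using sub gbb B'
      by (intro exI[of _ "insert b B"]) (auto simp: insert_iff ball_simps)
  qed
qed

text \<open>The columns of \<open>R\<close> are a basis that is orthonormal for \<open>G\<close> and orthogonal for \<open>W\<close>.\<close>

lemma simultaneous_diagonalization:
  fixes G W :: "real^'n^'n"
  assumes G: "transpose G = G" "\<And>v. v \<noteq> 0 \<Longrightarrow> 0 < v \<bullet> (G *v v)" and W: "transpose W = W"
  obtains R :: "real^'n^'n" and \<mu> :: "real^'n"
  where "transpose R ** G ** R = mat 1" "transpose R ** W ** R = (\<chi> i j. if i = j then \<mu> $ i else 0)"
proof -
  have sym: "x \<bullet> (M *v y) = y \<bullet> (M *v x)" if "transpose M = M" for M :: "real^'n^'n" and x y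
    by (metis dot_lmul_matrix inner_commute that transpose_matrix_vector)
  have bil: "bilinear (\<lambda>x y. x \<bullet> (M *v y))" for M :: "real^'n^'n"
    by (auto simp: bilinear_def linear_iff inner_add_left inner_add_right matrix_vector_right_distrib matrix_vector_mult_scaleR)
  obtain B where B: "span B = UNIV"
    "\<And>x y. x \<in> B \<Longrightarrow> y \<in> B \<Longrightarrow> x \<bullet> (G *v y) = (if x = y then 1 else 0)"
    "\<And>x y. x \<in> B \<Longrightarrow> y \<in> B \<Longrightarrow> x \<noteq> y \<Longrightarrow> x \<bullet> (W *v y) = 0"
    using simultaneous_orthogonal_basis[OF bil[of G] sym[OF G(1)] G(2) bil[of W] sym[OF W] subspace_UNIV]
    by metis
  have "independent B"
  proof
    assume "dependent B"
    then obtain a where a: "a \<in> B" "a \<in> span (B - {a})" by (auto simp: dependent_def)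
    have "a \<bullet> (G *v x) = 0" if "x \<in> span (B - {a})" for x
      using that
    proof (induction rule: span_induct)
      case base
      show ?case
        by (auto simp: subspace_def inner_add_right matrix_vector_right_distrib matrix_vector_mult_scaleR)
    next
      case (step x)
      then show ?case using B(2)[of a x] a(1) by auto
    qed
    then show False using a B(2)[of a a] by simp
  qed
  then have fin: "finite B" and card: "card B = CARD('n)"
    using B(1) by (auto simp: independent_imp_finite) (metis dim_UNIV dim_span dim_eq_card_independent DIM_cart DIM_real mult.right_neutral)
  obtain e :: "'n \<Rightarrow> real^'n" where e: "bij_betw e UNIV B"
    using finite_same_card_bij[OF finite fin] card by auto
  have eB: "e i \<in> B" for i using e by (auto simp: bij_betw_def)
  have ei: "e i = e j \<longleftrightarrow> i = j" for i j using e by (auto simp: bij_betw_def inj_on_def)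
  define R :: "real^'n^'n" where "R = (\<chi> i j. e j $ i)"
  have entry: "(transpose R ** M ** R) $ i $ j = e i \<bullet> (M *v e j)" for M i j
    by (simp add: R_def transpose_def matrix_matrix_mult_def matrix_vector_mult_def inner_vec_def
        sum_distrib_left sum_distrib_right mult.assoc) (rule sum.swap)
  show thesis
  proof
    show "transpose R ** G ** R = mat 1"
      unfolding vec_eq_iff entry by (simp add: B(2) eB ei mat_def)
    show "transpose R ** W ** R = (\<chi> i j. if i = j then (\<chi> i. e i \<bullet> (W *v e i)) $ i else 0)"
      unfolding vec_eq_iff entry by (simp add: B(3) eB ei)
  qed
qed

text \<open>A polynomial determines the multiset of its roots, and a multiset determines its sorted listing.
  This gives the uniqueness that the definite description in \<^const>\<open>sorted_eigenvalues\<close> relies on.\<close>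

lemma sorted_roots_unique:
  fixes \<mu> \<nu> :: "real^'n::{finite,linorder}"
  assumes "\<And>i j. i \<le> j \<Longrightarrow> \<mu> $ i \<le> \<mu> $ j" "\<And>i j. i \<le> j \<Longrightarrow> \<nu> $ i \<le> \<nu> $ j"
    and eq: "\<And>t. (\<Prod>i\<in>UNIV. t - \<mu> $ i) = (\<Prod>i\<in>UNIV. t - \<nu> $ i)"
  shows "\<mu> = \<nu>"
proof -
  define P where "P = (\<lambda>\<mu>::(real, 'n) vec. \<Prod>i\<in>UNIV. [:- \<mu> $ i, 1:])"
  define L where "L = (\<lambda>\<mu>::(real, 'n) vec. map (\<lambda>i. \<mu> $ i) (sorted_list_of_set UNIV))"
  have "poly (P \<mu>) t = (\<Prod>i\<in>UNIV. t - \<mu> $ i)" for \<mu> t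
    by (simp add: P_def poly_prod)
  then have "P \<mu> = P \<nu>" using eq by (metis poly_eqI2 poly_eq_poly_eq_iff ext)
  moreover have "proots (P \<mu>) = mset (L \<mu>)" for \<mu>
  proof -
    have "proots (P \<mu>) = (\<Sum>i\<in>UNIV. {#\<mu> $ i#})"
      unfolding P_def by (subst proots_prod) auto
    also have "\<dots> = image_mset (\<lambda>i. \<mu> $ i) (mset_set UNIV)"
      by (simp add: sum_unfold_sum_mset)
    also have "\<dots> = mset (L \<mu>)" by (simp add: L_def) (metis mset_sorted_list_of_multiset sorted_list_of_mset_set)
    finally show ?thesis .
  qed
  ultimately have "mset (L \<mu>) = mset (L \<nu>)" by metis
  moreover have "sorted (L \<xi>)" if "\<And>i j. i \<le> j \<Longrightarrow> \<xi> $ i \<le> \<xi> $ j" for \<xi>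
    unfolding L_def sorted_map using that
    by (intro sorted_wrt_mono_rel[OF _ sorted_sorted_list_of_set]) auto
  ultimately have "L \<mu> = L \<nu>"
    using assms by (metis properties_for_sort)
  then show ?thesis by (simp add: L_def vec_eq_iff)
qed

lemma sorted_rearrangement:
  fixes \<mu> :: "real^'n::{finite,linorder}"
  obtains \<nu> :: "real^'n::{finite,linorder}" and \<pi> where "\<pi> permutes UNIV" "\<And>i. \<nu> $ i = \<mu> $ \<pi> i" "\<And>i j. i \<le> j \<Longrightarrow> \<nu> $ i \<le> \<nu> $ j"
proof -
  define xs where "xs = sorted_list_of_set (UNIV :: 'n set)"
  define ys where "ys = sort_key (\<lambda>i. \<mu> $ i) xs"
  have len: "length xs = CARD('n)" "length ys = CARD('n)" by (simp_all add: xs_def ys_def)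
  have dist: "distinct xs" "distinct ys" "set xs = UNIV" "set ys = UNIV" by (simp_all add: xs_def ys_def)
  \<comment> \<open>The list \<open>xs\<close> enumerates the indices in their own order, \<open>ys\<close> by increasing value of \<open>\<mu>\<close>;
    \<open>\<pi>\<close> matches the two position by position.\<close>
  define \<pi> where "\<pi> = (\<lambda>x. ys ! (THE k. k < length xs \<and> xs ! k = x))"
  have the: "(THE k. k < length xs \<and> xs ! k = xs ! l) = l" if "l < length xs" for l
    using that dist(1) by (intro the_equality) (auto simp: nth_eq_iff_index_eq)
  have \<pi>: "\<pi> (xs ! l) = ys ! l" if "l < length xs" for l using the[OF that] by (simp add: \<pi>_def)
  have idx: "\<exists>k<length xs. xs ! k = x" for x using dist(3) by (metis UNIV_I in_set_conv_nth)
  have "inj \<pi>"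
  proof (rule injI)
    fix x y assume "\<pi> x = \<pi> y"
    obtain k l where "k < length xs" "xs ! k = x" "l < length xs" "xs ! l = y" using idx by metis
    with \<open>\<pi> x = \<pi> y\<close> \<pi> have "ys ! k = ys ! l" by metis
    then show "x = y" using dist(2) len \<open>k < _\<close> \<open>l < _\<close> \<open>xs ! k = x\<close> \<open>xs ! l = y\<close>
      by (simp add: nth_eq_iff_index_eq)
  qed
  then have "bij \<pi>" by (simp add: finite_UNIV_inj_surj bij_def)
  then have perm: "\<pi> permutes UNIV" by (intro bij_imp_permutes) auto
  have mono: "\<mu> $ \<pi> i \<le> \<mu> $ \<pi> j" if "i \<le> j" for i j
  proof -
    obtain k l where kl: "k < length xs" "xs ! k = i" "l < length xs" "xs ! l = j" using idx by metis
    have "k \<le> l"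
    proof (rule ccontr)
      assume "\<not> k \<le> l"
      then have "xs ! l \<le> xs ! k" using kl by (intro sorted_nth_mono) (auto simp: xs_def)
      then have "i = j" using that kl by auto
      then show False using kl dist(1) \<open>\<not> k \<le> l\<close> by (metis nth_eq_iff_index_eq order_refl)
    qed
    have "sorted (map (\<lambda>i. \<mu> $ i) ys)" by (simp add: ys_def)
    from sorted_nth_mono[OF this \<open>k \<le> l\<close>] show ?thesis using kl \<pi> len by (metis length_map nth_map)
  qed
  show thesis
    by (rule that[of \<pi> "\<chi> i. \<mu> $ \<pi> i"]) (use perm mono in auto)
qed

text \<open>To know the sorted eigenvalues, it is enough to factor the characteristic polynomial with its
  roots in any order.\<close>

lemma sorted_eigenvalues_eq:
  fixes P :: "real^('n::{finite,linorder})^('n::{finite,linorder})"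
  assumes "\<And>t. det (mat t - P) = (\<Prod>i\<in>UNIV. t - \<mu> $ i)"
  obtains \<pi> where "\<pi> permutes UNIV" "\<And>i. sorted_eigenvalues P $ i = \<mu> $ \<pi> i"
proof -
  obtain \<nu> \<pi> where \<pi>: "\<pi> permutes UNIV" and \<nu>: "\<And>i. \<nu> $ i = \<mu> $ \<pi> i" "\<And>i j. i \<le> j \<Longrightarrow> \<nu> $ i \<le> \<nu> $ j"
    using sorted_rearrangement[of \<mu>] by metis
  have eq: "det (mat t - P) = (\<Prod>i\<in>UNIV. t - \<nu> $ i)" for t
    unfolding assms \<nu>(1) using prod.permute[OF \<pi>, of "\<lambda>i. t - \<mu> $ i"] by (simp add: comp_def)
  have "sorted_eigenvalues P = \<nu>"
    unfolding sorted_eigenvalues_def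
  proof (rule the_equality)
    show "(\<forall>i j. i \<le> j \<longrightarrow> \<nu> $ i \<le> \<nu> $ j) \<and> (\<forall>t. det (mat t - P) = (\<Prod>i\<in>UNIV. t - \<nu> $ i))"
      using \<nu>(2) eq by blast
  next
    fix \<xi> :: "(real, 'n) vec"
    assume "(\<forall>i j. i \<le> j \<longrightarrow> \<xi> $ i \<le> \<xi> $ j) \<and> (\<forall>t. det (mat t - P) = (\<Prod>i\<in>UNIV. t - \<xi> $ i))"
    then show "\<xi> = \<nu>" using eq \<nu>(2) by (intro sorted_roots_unique) auto
  qed
  then show thesis using that[OF \<pi>] \<nu>(1) by simp
qed

text \<open>This is how a condition on the eigenvalues of \<open>G\<^sup>-\<^sup>1 W\<close> becomes an inequality between quadratic
  forms.  With \<open>R\<close> as in \<open>simultaneous_diagonalization\<close> the determinant of \<open>t - G\<^sup>-\<^sup>1 W\<close> is \<open>\<Prod>\<^sub>i (t - \<mu>\<^sub>i)\<close>, so the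
  eigenvalues are the diagonal entries of \<open>R\<^sup>T W R\<close>, and in the coordinates \<open>v = R z\<close> the claim reads
  \<open>a \<Sum>\<^sub>i z\<^sub>i\<^sup>2 \<le> \<Sum>\<^sub>i \<mu>\<^sub>i z\<^sub>i\<^sup>2\<close>.\<close>

lemma quadratic_form_ge_of_eigenvalues_ge:
  fixes G W :: "real^('n::{finite,linorder})^('n::{finite,linorder})"
  assumes G: "transpose G = G" "\<And>v. v \<noteq> 0 \<Longrightarrow> 0 < v \<bullet> (G *v v)" and W: "transpose W = W"
    and ge: "\<And>i. a \<le> sorted_eigenvalues (matrix_inv G ** W) $ i"
  shows "a * (v \<bullet> (G *v v)) \<le> v \<bullet> (W *v v)"
proof -
  obtain R :: "((real, 'n) vec, 'n) vec" and \<mu> :: "(real, 'n) vec" where R: "transpose R ** G ** R = mat 1"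
    "transpose R ** W ** R = (\<chi> i j. if i = j then \<mu> $ i else 0)"
    by (rule simultaneous_diagonalization[OF G W])
  have detR: "det R * det G * det R = 1"
    using arg_cong[OF R(1), of det] by (simp add: det_mul det_transpose)
  have "invertible G" "invertible R" using detR by (auto simp: invertible_det_nz)
  have inv: "G ** matrix_inv G = mat 1"
    using \<open>invertible G\<close> unfolding invertible_def matrix_inv_def by (rule someI2_ex) blast
  have "det (mat t - matrix_inv G ** W) = (\<Prod>i\<in>UNIV. t - \<mu> $ i)" for t
  proof -
    have "transpose R ** (G ** (mat t - matrix_inv G ** W)) ** R =
        t *\<^sub>R (transpose R ** G ** R) - transpose R ** W ** R"
    proof -
      have "mat t *v z = t *\<^sub>R z" for z :: "(real, 'n) vec"
        by (simp add: vec_eq_iff matrix_vector_mult_def mat_def if_distrib[where f="\<lambda>x. x * _"] cong: if_cong)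
      moreover have "G *v (matrix_inv G *v z) = z" for z
        by (simp add: matrix_vector_mul_assoc inv)
      ultimately show ?thesis
        by (simp add: matrix_eq matrix_vector_mul_assoc[symmetric] scaleR_matrix_vector_assoc[symmetric]
            matrix_vector_mult_diff_rdistrib matrix_vector_mult_diff_distrib matrix_vector_mult_scaleR
            vector_matrix_mult_diff_distrib vector_scaleR_matrix_ac
            vector_matrix_left_distrib)
    qed
    also have "\<dots> = (\<chi> i j. if i = j then t - \<mu> $ i else 0)"
      unfolding R by (simp add: vec_eq_iff mat_def)
    finally have "det (transpose R ** (G ** (mat t - matrix_inv G ** W)) ** R) =
        det ((\<chi> i j. if i = j then t - \<mu> $ i else 0) :: ((real, 'n) vec, 'n) vec)"
      by (rule arg_cong)
    then have "det R * (det G * det (mat t - matrix_inv G ** W)) * det R =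
        det ((\<chi> i j. if i = j then t - \<mu> $ i else 0) :: ((real, 'n) vec, 'n) vec)"
      by (simp only: det_mul det_transpose)
    also have "\<dots> = (\<Prod>i\<in>UNIV. t - \<mu> $ i)" by (subst det_diagonal) auto
    also have "det R * (det G * det (mat t - matrix_inv G ** W)) * det R
       = (det R * det G * det R) * det (mat t - matrix_inv G ** W)" by (simp add: ac_simps)
    finally show ?thesis using detR by simp
  qed
  then obtain \<pi> where "\<pi> permutes UNIV" "\<And>i. sorted_eigenvalues (matrix_inv G ** W) $ i = \<mu> $ \<pi> i"
    using sorted_eigenvalues_eq by metis
  then have \<mu>: "a \<le> \<mu> $ i" for i using ge by (metis permutes_surj surjD)
  obtain z where z: "v = R *v z"
    using \<open>invertible R\<close> by (metis invertible_def matrix_vector_mul_assoc matrix_vector_mul_lid)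
  have form: "v \<bullet> (M *v v) = z \<bullet> ((transpose R ** M ** R) *v z)" for M
  proof -
    have "z \<bullet> ((transpose R ** M ** R) *v z) = z \<bullet> ((M *v (R *v z)) v* R)"
      by (simp add: matrix_vector_mul_assoc[symmetric])
    also have "\<dots> = (M *v (R *v z)) \<bullet> (R *v z)"
      by (metis dot_lmul_matrix inner_commute)
    finally show ?thesis by (simp add: z inner_commute)
  qed
  have "v \<bullet> (G *v v) = (\<Sum>i\<in>UNIV. (z $ i)\<^sup>2)"
    unfolding form R by (simp add: inner_vec_def power2_eq_square)
  moreover have "v \<bullet> (W *v v) = (\<Sum>i\<in>UNIV. \<mu> $ i * (z $ i)\<^sup>2)"
    unfolding form R
    by (simp add: inner_vec_def power2_eq_square matrix_vector_mult_def if_distrib[where f="\<lambda>x. x * _"] cong: if_cong)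
      (simp add: ac_simps)
  ultimately show ?thesis using \<mu> by (auto simp: sum_distrib_left intro!: sum_mono mult_right_mono)
qed

section \<open>Directional derivatives and the symmetry of second derivatives\<close>

lemma has_real_derivative_along_line:
  fixes f :: "'a::real_normed_vector \<Rightarrow> real"
  assumes "f differentiable at (a + t *\<^sub>R v)"
  shows "((\<lambda>t. f (a + t *\<^sub>R v)) has_real_derivative frechet_derivative f (at (a + t *\<^sub>R v)) v) (at t)"
proof -
  let ?D = "frechet_derivative f (at (a + t *\<^sub>R v))"
  have D: "(f has_derivative ?D) (at (a + t *\<^sub>R v))"
    using assms frechet_derivative_works by blast
  have "((\<lambda>t. a + t *\<^sub>R v) has_derivative (\<lambda>s. s *\<^sub>R v)) (at t)"
    by (auto intro!: derivative_eq_intros)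
  from has_derivative_compose[OF this D]
  have "((\<lambda>t. f (a + t *\<^sub>R v)) has_derivative (\<lambda>s. ?D (s *\<^sub>R v))) (at t)" .
  moreover have "?D (s *\<^sub>R v) = ?D v * s" for s
    using has_derivative_linear[OF D] by (simp add: linear_cmul)
  ultimately show ?thesis by (simp add: has_field_derivative_def mult_commute_abs)
qed

text \<open>The mean value theorem is applied once in the direction \<open>v\<close> to the difference
  \<open>f (\<cdot> + h w) - f (\<cdot>)\<close>, and then in the direction \<open>w\<close> to the derivative of \<open>f\<close> along \<open>v\<close>.\<close>

lemma second_difference_mean_value:
  fixes f :: "'a::real_normed_vector \<Rightarrow> real"
  assumes "0 < h"
    and df: "\<And>s t. s \<in> {0..h} \<Longrightarrow> t \<in> {0..h} \<Longrightarrow> f differentiable at (y + s *\<^sub>R v + t *\<^sub>R w)"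
    and ddf: "\<And>s t. s \<in> {0..h} \<Longrightarrow> t \<in> {0..h} \<Longrightarrow>
      (\<lambda>z. frechet_derivative f (at z) v) differentiable at (y + s *\<^sub>R v + t *\<^sub>R w)"
  obtains s t where "s \<in> {0..h}" "t \<in> {0..h}"
    "f (y + h *\<^sub>R v + h *\<^sub>R w) - f (y + h *\<^sub>R v) - (f (y + h *\<^sub>R w) - f y) =
       h * (h * frechet_derivative (\<lambda>z. frechet_derivative f (at z) v) (at (y + s *\<^sub>R v + t *\<^sub>R w)) w)"
proof -
  let ?D = "\<lambda>z. frechet_derivative f (at z) v"
  have "((\<lambda>s. f (y + s *\<^sub>R v + h *\<^sub>R w) - f (y + s *\<^sub>R v)) has_real_derivative
      ?D (y + s *\<^sub>R v + h *\<^sub>R w) - ?D (y + s *\<^sub>R v)) (at s)" if "0 \<le> s" "s \<le> h" for s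
  proof (rule DERIV_diff)
    show "((\<lambda>s. f (y + s *\<^sub>R v + h *\<^sub>R w)) has_real_derivative ?D (y + s *\<^sub>R v + h *\<^sub>R w)) (at s)"
      using has_real_derivative_along_line[of f "y + h *\<^sub>R w" s v] df[of s h] that \<open>0 < h\<close>
      by (simp add: ac_simps)
    show "((\<lambda>s. f (y + s *\<^sub>R v)) has_real_derivative ?D (y + s *\<^sub>R v)) (at s)"
      using has_real_derivative_along_line[of f y s v] df[of s 0] that \<open>0 < h\<close> by simp
  qed
  from MVT2[OF \<open>0 < h\<close> this] obtain s where s: "0 < s" "s < h"
    "f (y + h *\<^sub>R v + h *\<^sub>R w) - f (y + h *\<^sub>R v) - (f (y + h *\<^sub>R w) - f y)
      = h * (?D (y + s *\<^sub>R v + h *\<^sub>R w) - ?D (y + s *\<^sub>R v))"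
    by auto
  have "((\<lambda>t. ?D (y + s *\<^sub>R v + t *\<^sub>R w)) has_real_derivative
      frechet_derivative ?D (at (y + s *\<^sub>R v + t *\<^sub>R w)) w) (at t)" if "0 \<le> t" "t \<le> h" for t
    using has_real_derivative_along_line[of ?D "y + s *\<^sub>R v" t w] ddf[of s t] that s by simp
  from MVT2[OF \<open>0 < h\<close> this] obtain t where t: "0 < t" "t < h"
    "?D (y + s *\<^sub>R v + h *\<^sub>R w) - ?D (y + s *\<^sub>R v) =
      h * frechet_derivative ?D (at (y + s *\<^sub>R v + t *\<^sub>R w)) w"
    by auto
  show thesis using that[of s t] s t by simp
qed

text \<open>The second difference of \<open>f\<close> over a small parallelogram is symmetric in \<open>v\<close> and \<open>w\<close>.  By
  \<open>second_difference_mean_value\<close> it is \<open>h\<^sup>2\<close> times a value of either mixed derivative near \<open>y\<close>,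
  and both mixed derivatives are continuous.\<close>

lemma mixed_derivatives_commute:
  fixes f :: "'a::euclidean_space \<Rightarrow> real"
  assumes "open S" "y \<in> S" and f: "Ck_on 2 f S"
  shows "frechet_derivative (\<lambda>z. frechet_derivative f (at z) v) (at y) w =
         frechet_derivative (\<lambda>z. frechet_derivative f (at z) w) (at y) v" (is "?L y = ?R y")
proof (rule ccontr)
  assume "?L y \<noteq> ?R y"
  define e where "e = \<bar>?L y - ?R y\<bar> / 2"
  have "e > 0" using \<open>?L y \<noteq> ?R y\<close> by (simp add: e_def)
  have d1: "f differentiable at z" if "z \<in> S" for z
    using f that by (simp add: numeral_2_eq_2)
  have d2: "(\<lambda>z. frechet_derivative f (at z) v) differentiable at z" if "z \<in> S" for z v
    using f that by (simp add: numeral_2_eq_2)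
  have "continuous_on S ?L" "continuous_on S ?R"
    using f by (simp_all add: numeral_2_eq_2)
  then have "isCont ?L y" "isCont ?R y"
    using assms(1,2) by (simp_all add: continuous_on_eq_continuous_at)
  then obtain d1' d2' where d': "d1' > 0" "d2' > 0"
    "\<And>z. dist z y < d1' \<Longrightarrow> dist (?L z) (?L y) < e" "\<And>z. dist z y < d2' \<Longrightarrow> dist (?R z) (?R y) < e"
    using \<open>e > 0\<close> unfolding continuous_at_eps_delta by metis
  obtain d3 where "d3 > 0" "ball y d3 \<subseteq> S" using assms(1,2) openE by blast
  define d where "d = min (min d1' d2') d3"
  have "d > 0" using d' \<open>d3 > 0\<close> by (simp add: d_def)
  \<comment> \<open>So small that the whole parallelogram spanned by \<open>h v\<close> and \<open>h w\<close> at \<open>y\<close> is within distance \<open>d\<close>.\<close>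
  define h where "h = d / (norm v + norm w + 1)"
  have den: "norm v + norm w + 1 > 0" by (simp add: add_nonneg_pos)
  have "h > 0" using \<open>d > 0\<close> den by (simp add: h_def)
  have near: "dist (y + s *\<^sub>R v + t *\<^sub>R w) y < d" if "s \<in> {0..h}" "t \<in> {0..h}" for s t
  proof -
    have "dist (y + s *\<^sub>R v + t *\<^sub>R w) y = norm (s *\<^sub>R v + t *\<^sub>R w)" by (simp add: dist_norm algebra_simps)
    also have "\<dots> \<le> norm (s *\<^sub>R v) + norm (t *\<^sub>R w)" by (rule norm_triangle_ineq)
    also have "\<dots> = s * norm v + t * norm w" using that by simp
    also have "\<dots> \<le> h * norm v + h * norm w" using that by (intro add_mono mult_right_mono) auto
    also have "\<dots> < h * (norm v + norm w + 1)" using \<open>h > 0\<close> by (simp add: algebra_simps)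
    also have "\<dots> = d" using den by (simp add: h_def)
    finally show ?thesis .
  qed
  then have inS: "y + s *\<^sub>R v + t *\<^sub>R w \<in> S" if "s \<in> {0..h}" "t \<in> {0..h}" for s t
    using \<open>ball y d3 \<subseteq> S\<close> that by (force simp: d_def dist_commute)
  obtain s t where st: "s \<in> {0..h}" "t \<in> {0..h}"
    "f (y + h *\<^sub>R v + h *\<^sub>R w) - f (y + h *\<^sub>R v) - (f (y + h *\<^sub>R w) - f y) = h * (h * ?L (y + s *\<^sub>R v + t *\<^sub>R w))"
    by (rule second_difference_mean_value[of h f y v w]) (use \<open>h > 0\<close> d1 d2 inS in auto)
  have swap: "y + t *\<^sub>R w + s *\<^sub>R v = y + s *\<^sub>R v + t *\<^sub>R w" for s t by simp
  have inS': "y + t *\<^sub>R w + s *\<^sub>R v \<in> S" if "s \<in> {0..h}" "t \<in> {0..h}" for s t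
    unfolding swap using that by (rule inS)
  obtain t' s' where st': "t' \<in> {0..h}" "s' \<in> {0..h}"
    "f (y + h *\<^sub>R w + h *\<^sub>R v) - f (y + h *\<^sub>R w) - (f (y + h *\<^sub>R v) - f y) = h * (h * ?R (y + t' *\<^sub>R w + s' *\<^sub>R v))"
    by (rule second_difference_mean_value[of h f y w v]) (use \<open>h > 0\<close> d1 d2 inS' in auto)
  have "h * (h * ?L (y + s *\<^sub>R v + t *\<^sub>R w)) = h * (h * ?R (y + s' *\<^sub>R v + t' *\<^sub>R w))"
    unfolding st(3)[symmetric] st'(3)[unfolded swap, symmetric] by (simp add: algebra_simps)
  then have "?L (y + s *\<^sub>R v + t *\<^sub>R w) = ?R (y + s' *\<^sub>R v + t' *\<^sub>R w)"
    using \<open>h > 0\<close> by simp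
  moreover have "dist (?L (y + s *\<^sub>R v + t *\<^sub>R w)) (?L y) < e"
    using near[OF st(1,2)] by (intro d'(3)) (simp add: d_def)
  moreover have "dist (?R (y + s' *\<^sub>R v + t' *\<^sub>R w)) (?R y) < e"
    using near[OF st'(2,1)] by (intro d'(4)) (simp add: d_def)
  ultimately show False by (simp add: dist_real_def e_def abs_if field_simps split: if_splits)
qed

lemma frechet_derivative_cong_open:
  assumes "open S" "x \<in> S" "\<And>z. z \<in> S \<Longrightarrow> f z = h z"
  shows "frechet_derivative f (at x) = frechet_derivative h (at x)"
proof -
  have "(f has_derivative D) (at x) \<longleftrightarrow> (h has_derivative D) (at x)" for D
    using assms by (metis has_derivative_transform_within_open)
  then show ?thesis by (simp add: frechet_derivative_def)
qed

lemma frechet_derivative_sum_axis: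
  fixes f :: "real^'n \<Rightarrow> 'b::real_normed_vector"
  assumes "f differentiable at y"
  shows "frechet_derivative f (at y) v = (\<Sum>i\<in>UNIV. v $ i *\<^sub>R frechet_derivative f (at y) (axis i 1))"
proof -
  have lin: "linear (frechet_derivative f (at y))"
    using assms linear_frechet_derivative by blast
  have "v = (\<Sum>i\<in>UNIV. v $ i *\<^sub>R axis i 1)"
    using basis_expansion[of v] by (simp add: scalar_mult_eq_scaleR)
  then have "frechet_derivative f (at y) v = frechet_derivative f (at y) (\<Sum>i\<in>UNIV. v $ i *\<^sub>R axis i 1)"
    by simp
  then show ?thesis by (simp add: linear_sum[OF lin] linear_cmul[OF lin])
qed

section \<open>Charts, tangent vectors and bilinear forms\<close>

locale smooth_atlas =
  fixes X :: "'m topology" and \<A> :: "('m, 'n::finite) chart set"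
  assumes manifold: "smooth_manifold X \<A>"
begin

lemma charts_atD: "c \<in> charts_at \<A> x \<Longrightarrow> c \<in> \<A>" "c \<in> charts_at \<A> x \<Longrightarrow> x \<in> fst c"
  by (simp_all add: charts_at_def)

lemma chart_at_in: "x \<in> topspace X \<Longrightarrow> chart_at \<A> x \<in> charts_at \<A> x"
proof -
  assume "x \<in> topspace X"
  then have "\<exists>c. c \<in> charts_at \<A> x"
    using manifold unfolding smooth_manifold_def charts_at_def by blast
  then show ?thesis unfolding chart_at_def by (rule someI_ex)
qed

context
  fixes c assumes c: "c \<in> \<A>"
begin

lemma open_chart_image: "open (chart_image c)"
  using manifold c by (auto simp: smooth_manifold_def)

lemma chart_domain_open: "openin X (fst c)"
  using manifold c by (auto simp: smooth_manifold_def)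

lemma chart_domain_subset: "x \<in> fst c \<Longrightarrow> x \<in> topspace X"
  using chart_domain_open openin_subset by blast

lemma chart_homeomorphic: "homeomorphic_map (subtopology X (fst c)) (top_of_set (chart_image c)) (snd c)"
  using manifold c by (auto simp: smooth_manifold_def)

lemma chart_inj: "inj_on (snd c) (fst c)"
proof -
  have "inj_on (snd c) (topspace (subtopology X (fst c)))"
    using chart_homeomorphic by (rule homeomorphic_imp_injective_map)
  moreover have "topspace (subtopology X (fst c)) = fst c"
    using chart_domain_subset by auto
  ultimately show ?thesis by simp
qed

lemma chart_inv_chart: "x \<in> fst c \<Longrightarrow> chart_inv c (snd c x) = x"
  using chart_inj by (simp add: chart_inv_def)

lemma chart_in_image: "x \<in> fst c \<Longrightarrow> snd c x \<in> chart_image c"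
  by (simp add: chart_image_def)

lemma chart_inv_in: "y \<in> chart_image c \<Longrightarrow> chart_inv c y \<in> fst c"
  by (auto simp: chart_image_def chart_inv_def inv_into_into)

lemma chart_chart_inv: "y \<in> chart_image c \<Longrightarrow> snd c (chart_inv c y) = y"
  by (simp add: chart_image_def chart_inv_def f_inv_into_f)

lemma open_chart_overlap:
  assumes "d \<in> \<A>"
  shows "open (snd c ` (fst c \<inter> fst d))"
proof -
  have "openin X (fst d)" using manifold assms by (auto simp: smooth_manifold_def)
  then have "openin (subtopology X (fst c)) (fst c \<inter> fst d)"
    by (metis inf_commute openin_subtopology_Int)
  then have "openin (top_of_set (chart_image c)) (snd c ` (fst c \<inter> fst d))"
    using chart_homeomorphic homeomorphic_imp_open_map open_map_def by blast
  then show ?thesis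
    using open_chart_image openin_open_eq by blast
qed

end

lemma in_charts_at_inv: "c \<in> \<A> \<Longrightarrow> y \<in> chart_image c \<Longrightarrow> c \<in> charts_at \<A> (chart_inv c y)"
  by (simp add: charts_at_def chart_inv_in)

lemma transition_differentiable:
  assumes "c \<in> charts_at \<A> x" "d \<in> charts_at \<A> x"
  shows "(snd d \<circ> chart_inv c) differentiable at (snd c x)"
proof -
  have "smooth_on (snd d \<circ> chart_inv c) (snd c ` (fst c \<inter> fst d))"
    using manifold assms by (auto simp: smooth_manifold_def charts_at_def)
  then have "Ck_on (Suc 0) (snd d \<circ> chart_inv c) (snd c ` (fst c \<inter> fst d))"
    unfolding smooth_on_def by blast
  then show ?thesis using assms by (auto simp: charts_at_def)
qed

text \<open>The chain rule for the transition map.  It serves for real functions on the manifold and, with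
  the coordinate map of a third chart as \<open>F\<close>, for the cocycle property of the Jacobians.\<close>

lemma change_of_chart:
  fixes F :: "'m \<Rightarrow> 'b::real_normed_vector"
  assumes c: "c \<in> charts_at \<A> x" and d: "d \<in> charts_at \<A> x"
    and F: "(F \<circ> chart_inv d) differentiable at (snd d x)"
  shows "frechet_derivative (F \<circ> chart_inv c) (at (snd c x)) v =
     frechet_derivative (F \<circ> chart_inv d) (at (snd d x))
       (frechet_derivative (snd d \<circ> chart_inv c) (at (snd c x)) v)"
proof -
  let ?T = "snd d \<circ> chart_inv c"
  note cA = charts_atD[OF c] and dA = charts_atD[OF d]
  have T: "(?T has_derivative frechet_derivative ?T (at (snd c x))) (at (snd c x))"
    using transition_differentiable[OF c d] frechet_derivative_works by blast
  have "?T (snd c x) = snd d x" by (simp add: chart_inv_chart[OF cA])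
  then have "(F \<circ> chart_inv d has_derivative frechet_derivative (F \<circ> chart_inv d) (at (snd d x))) (at (?T (snd c x)))"
    using F frechet_derivative_works by metis
  from diff_chain_at[OF T this]
  have "(F \<circ> chart_inv d \<circ> ?T has_derivative
     frechet_derivative (F \<circ> chart_inv d) (at (snd d x)) \<circ> frechet_derivative ?T (at (snd c x))) (at (snd c x))" .
  then have "(F \<circ> chart_inv c has_derivative
     frechet_derivative (F \<circ> chart_inv d) (at (snd d x)) \<circ> frechet_derivative ?T (at (snd c x))) (at (snd c x))"
  proof (rule has_derivative_transform_within_open)
    show "open (snd c ` (fst c \<inter> fst d))" using open_chart_overlap cA(1) dA(1) by blast
    show "snd c x \<in> snd c ` (fst c \<inter> fst d)" using cA(2) dA(2) by blast
    show "(F \<circ> chart_inv d \<circ> ?T) y = (F \<circ> chart_inv c) y" if "y \<in> snd c ` (fst c \<inter> fst d)" for y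
      using that chart_inv_chart[OF cA(1)] chart_inv_chart[OF dA(1)] by auto
  qed
  then show ?thesis by (metis frechet_derivative_at comp_apply)
qed

lemma transition_self:
  assumes c: "c \<in> charts_at \<A> x"
  shows "frechet_derivative (snd c \<circ> chart_inv c) (at (snd c x)) v = v"
proof -
  note cA = charts_atD[OF c]
  have "frechet_derivative (snd c \<circ> chart_inv c) (at (snd c x)) = frechet_derivative (\<lambda>y. y) (at (snd c x))"
    by (rule frechet_derivative_cong_open[OF open_chart_image[OF cA(1)]])
      (use cA chart_in_image chart_chart_inv in auto)
  then show ?thesis by simp
qed

lemma coord_vec_self:
  "c \<in> charts_at \<A> x \<Longrightarrow> coord_vec \<A> c x i c = axis i 1"
  by (simp add: coord_vec_def transition_self)

lemma tangent_spaceI: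
  assumes "\<And>c. c \<notin> charts_at \<A> x \<Longrightarrow> v c = 0"
    and "\<And>c d. c \<in> charts_at \<A> x \<Longrightarrow> d \<in> charts_at \<A> x \<Longrightarrow>
      v d = frechet_derivative (snd d \<circ> chart_inv c) (at (snd c x)) (v c)"
  shows "v \<in> tangent_space \<A> x"
  unfolding tangent_space_def using assms by blast

lemma tangent_spaceD:
  assumes "v \<in> tangent_space \<A> x"
  shows "c \<notin> charts_at \<A> x \<Longrightarrow> v c = 0"
    and "c \<in> charts_at \<A> x \<Longrightarrow> d \<in> charts_at \<A> x \<Longrightarrow>
      frechet_derivative (snd d \<circ> chart_inv c) (at (snd c x)) (v c) = v d"
proof -
  have v: "\<forall>c. c \<notin> charts_at \<A> x \<longrightarrow> v c = 0"
    "\<forall>c\<in>charts_at \<A> x. \<forall>d\<in>charts_at \<A> x.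
        v d = frechet_derivative (snd d \<circ> chart_inv c) (at (snd c x)) (v c)"
    using assms unfolding tangent_space_def by blast+
  show "c \<notin> charts_at \<A> x \<Longrightarrow> v c = 0" using v(1) by blast
  show "frechet_derivative (snd d \<circ> chart_inv c) (at (snd c x)) (v c) = v d"
    if "c \<in> charts_at \<A> x" "d \<in> charts_at \<A> x"
    using bspec[OF bspec[OF v(2) that(1)] that(2)] by (rule sym)
qed

text \<open>The transformation rule is the cocycle property of the Jacobians.\<close>

lemma coord_vec_tangent:
  assumes c: "c \<in> charts_at \<A> x"
  shows "coord_vec \<A> c x i \<in> tangent_space \<A> x"
proof (rule tangent_spaceI)
  fix d e assume d: "d \<in> charts_at \<A> x" and e: "e \<in> charts_at \<A> x"
  show "coord_vec \<A> c x i e = frechet_derivative (snd e \<circ> chart_inv d) (at (snd d x)) (coord_vec \<A> c x i d)"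
    using change_of_chart[OF c d transition_differentiable[OF d e]] d e
    by (simp only: coord_vec_def if_True)
qed (simp add: coord_vec_def)

lemma tangent_space_lincomb:
  assumes v: "v \<in> tangent_space \<A> x" and w: "w \<in> tangent_space \<A> x"
  shows "(\<lambda>c. a *\<^sub>R v c + b *\<^sub>R w c) \<in> tangent_space \<A> x"
proof (rule tangent_spaceI)
  fix c d assume cd: "c \<in> charts_at \<A> x" "d \<in> charts_at \<A> x"
  then have "linear (frechet_derivative (snd d \<circ> chart_inv c) (at (snd c x)))"
    by (intro linear_frechet_derivative transition_differentiable)
  from linear_add[OF this, of "a *\<^sub>R v c" "b *\<^sub>R w c"] linear_cmul[OF this]
  show "a *\<^sub>R v d + b *\<^sub>R w d =
      frechet_derivative (snd d \<circ> chart_inv c) (at (snd c x)) (a *\<^sub>R v c + b *\<^sub>R w c)"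
    using tangent_spaceD(2)[OF v cd] tangent_spaceD(2)[OF w cd] by simp
qed (simp add: tangent_spaceD(1)[OF v] tangent_spaceD(1)[OF w])

lemma zero_tangent: "(\<lambda>c. 0) \<in> tangent_space \<A> x"
proof (rule tangent_spaceI)
  fix c d assume "c \<in> charts_at \<A> x" "d \<in> charts_at \<A> x"
  then have "linear (frechet_derivative (snd d \<circ> chart_inv c) (at (snd c x)))"
    by (intro linear_frechet_derivative transition_differentiable)
  from linear_0[OF this] show "0 = frechet_derivative (snd d \<circ> chart_inv c) (at (snd c x)) 0"
    by (rule sym)
qed simp

lemma tangent_linearD:
  assumes "tangent_linear \<A> x f" "v \<in> tangent_space \<A> x" "w \<in> tangent_space \<A> x"
  shows "f (\<lambda>c. a *\<^sub>R v c + b *\<^sub>R w c) = a * f v + b * f w"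
  using assms by (simp add: tangent_linear_def)

text \<open>Both claims are proved together, since linearity of \<open>f\<close> may only be used on tangent vectors.\<close>

lemma tangent_sum_coord_vec:
  assumes c: "c \<in> charts_at \<A> x" and "finite I" and f: "tangent_linear \<A> x f"
  shows "(\<lambda>d. \<Sum>i\<in>I. \<xi> $ i *\<^sub>R coord_vec \<A> c x i d) \<in> tangent_space \<A> x \<and>
    f (\<lambda>d. \<Sum>i\<in>I. \<xi> $ i *\<^sub>R coord_vec \<A> c x i d) = (\<Sum>i\<in>I. \<xi> $ i * f (coord_vec \<A> c x i))"
  using \<open>finite I\<close>
proof induction
  case empty
  have "f (\<lambda>c. 0 *\<^sub>R (0::real^'n) + 0 *\<^sub>R 0) = 0 * f (\<lambda>c. 0) + 0 * f (\<lambda>c. 0)"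
    by (rule tangent_linearD[OF f zero_tangent zero_tangent])
  then show ?case using zero_tangent by simp
next
  case (insert i I)
  let ?w = "\<lambda>d. \<Sum>i\<in>I. \<xi> $ i *\<^sub>R coord_vec \<A> c x i d"
  have w: "?w \<in> tangent_space \<A> x" "f ?w = (\<Sum>i\<in>I. \<xi> $ i * f (coord_vec \<A> c x i))"
    using insert.IH by auto
  have eq: "(\<lambda>d. \<Sum>i\<in>insert i I. \<xi> $ i *\<^sub>R coord_vec \<A> c x i d) =
     (\<lambda>d. \<xi> $ i *\<^sub>R coord_vec \<A> c x i d + 1 *\<^sub>R ?w d)"
    using insert.hyps by (simp add: fun_eq_iff)
  have "f (\<lambda>d. \<xi> $ i *\<^sub>R coord_vec \<A> c x i d + 1 *\<^sub>R ?w d) = \<xi> $ i * f (coord_vec \<A> c x i) + 1 * f ?w"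
    by (rule tangent_linearD[OF f coord_vec_tangent[OF c] w(1)])
  then show ?case
    unfolding eq using tangent_space_lincomb[OF coord_vec_tangent[OF c] w(1), where a = "\<xi> $ i" and b = 1] w(2) insert.hyps by simp
qed

text \<open>The expansion has to be checked in every chart \<open>d\<close>, not only in \<open>c\<close>; there it is linearity of
  the Jacobian of the transition map.\<close>

lemma tangent_expansion:
  assumes c: "c \<in> charts_at \<A> x" and v: "v \<in> tangent_space \<A> x"
  shows "v = (\<lambda>d. \<Sum>i\<in>UNIV. v c $ i *\<^sub>R coord_vec \<A> c x i d)"
proof
  fix d
  show "v d = (\<Sum>i\<in>UNIV. v c $ i *\<^sub>R coord_vec \<A> c x i d)"
  proof (cases "d \<in> charts_at \<A> x")
    case True
    then have "v d = frechet_derivative (snd d \<circ> chart_inv c) (at (snd c x)) (v c)"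
      using tangent_spaceD(2)[OF v c] by simp
    also have "\<dots> = (\<Sum>i\<in>UNIV. v c $ i *\<^sub>R coord_vec \<A> c x i d)"
      using True frechet_derivative_sum_axis[OF transition_differentiable[OF c True], of "v c"]
      by (simp add: coord_vec_def)
    finally show ?thesis .
  next
    case False
    then show ?thesis using tangent_spaceD(1)[OF v] by (simp add: coord_vec_def)
  qed
qed

lemma tangent_linear_expansion:
  assumes "c \<in> charts_at \<A> x" "v \<in> tangent_space \<A> x" "tangent_linear \<A> x f"
  shows "f v = (\<Sum>i\<in>UNIV. v c $ i * f (coord_vec \<A> c x i))"
  using tangent_sum_coord_vec[OF assms(1) finite assms(3), where I = UNIV and \<xi> = "v c"]
    tangent_expansion[OF assms(1,2)] by simp

lemma tangent_vector_with_components: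
  assumes c: "c \<in> charts_at \<A> x"
  obtains v where "v \<in> tangent_space \<A> x" "v c = \<xi>"
proof
  have "tangent_linear \<A> x (\<lambda>_. 0)" by (simp add: tangent_linear_def)
  from conjunct1[OF tangent_sum_coord_vec[OF c finite this]]
  show "(\<lambda>d. \<Sum>i\<in>UNIV. \<xi> $ i *\<^sub>R coord_vec \<A> c x i d) \<in> tangent_space \<A> x" .
  show "(\<Sum>i\<in>UNIV. \<xi> $ i *\<^sub>R coord_vec \<A> c x i c) = \<xi>"
    using basis_expansion[of \<xi>] by (simp add: coord_vec_self[OF c] scalar_mult_eq_scaleR)
qed

lemma symmetric_bilinear_expansion:
  assumes c: "c \<in> charts_at \<A> x" and B: "symmetric_bilinear \<A> x B"
    and v: "v \<in> tangent_space \<A> x" and w: "w \<in> tangent_space \<A> x"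
  shows "B v w = v c \<bullet> (tensor_matrix \<A> c x B *v w c)"
proof -
  have lin: "tangent_linear \<A> x (\<lambda>v. B v w)" if "w \<in> tangent_space \<A> x" for w
    using B that by (simp add: symmetric_bilinear_def)
  have sym: "B v w = B w v" if "v \<in> tangent_space \<A> x" "w \<in> tangent_space \<A> x" for v w
    using B that by (simp add: symmetric_bilinear_def)
  have "B (coord_vec \<A> c x i) w = (\<Sum>j\<in>UNIV. w c $ j * B (coord_vec \<A> c x i) (coord_vec \<A> c x j))" for i
  proof -
    have "B (coord_vec \<A> c x i) w = B w (coord_vec \<A> c x i)"
      by (rule sym[OF coord_vec_tangent[OF c] w])
    also have "\<dots> = (\<Sum>j\<in>UNIV. w c $ j * B (coord_vec \<A> c x j) (coord_vec \<A> c x i))"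
      by (rule tangent_linear_expansion[OF c w lin[OF coord_vec_tangent[OF c]]])
    also have "\<dots> = (\<Sum>j\<in>UNIV. w c $ j * B (coord_vec \<A> c x i) (coord_vec \<A> c x j))"
      by (rule sum.cong) (simp_all only: sym[OF coord_vec_tangent[OF c, of i] coord_vec_tangent[OF c]])
    finally show ?thesis .
  qed
  then show ?thesis
    using tangent_linear_expansion[OF c v lin[OF w]]
    by (simp add: inner_vec_def matrix_vector_mult_def tensor_matrix_def mult.commute)
qed

lemma tensor_matrix_symmetric:
  assumes "c \<in> charts_at \<A> x" "symmetric_bilinear \<A> x B"
  shows "transpose (tensor_matrix \<A> c x B) = tensor_matrix \<A> c x B"
  using assms coord_vec_tangent[OF assms(1)]
  by (simp add: transpose_def tensor_matrix_def vec_eq_iff symmetric_bilinear_def)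

lemma continuous_map_from_charts:
  fixes f :: "'m \<Rightarrow> real"
  assumes "\<And>c. c \<in> \<A> \<Longrightarrow> continuous_on (chart_image c) (f \<circ> chart_inv c)"
  shows "continuous_map X euclideanreal f"
proof (rule pasting_lemma[where I = \<A> and T = fst and f = "\<lambda>_. f"])
  show "openin X (fst c)" if "c \<in> \<A>" for c using that by (rule chart_domain_open)
  show "continuous_map (subtopology X (fst c)) euclideanreal f" if c: "c \<in> \<A>" for c
  proof -
    have "continuous_map (subtopology X (fst c)) (top_of_set (chart_image c)) (snd c)"
      using chart_homeomorphic[OF c] homeomorphic_imp_continuous_map by blast
    moreover have "continuous_map (top_of_set (chart_image c)) euclideanreal (f \<circ> chart_inv c)"
      using assms[OF c] by simp
    ultimately have "continuous_map (subtopology X (fst c)) euclideanreal ((f \<circ> chart_inv c) \<circ> snd c)"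
      by (rule continuous_map_compose)
    then show ?thesis
      by (rule continuous_map_eq) (use chart_inv_chart[OF c] in auto)
  qed
  show "\<exists>c. c \<in> \<A> \<and> x \<in> fst c \<and> f x = f x" if "x \<in> topspace X" for x
    using that manifold unfolding smooth_manifold_def by blast
qed auto

end

section \<open>The metric and the norm of the differential\<close>

lemma matrix_inv_vector:
  fixes M :: "real^'n^'n"
  assumes "invertible M"
  shows "M *v (matrix_inv M *v a) = a" "matrix_inv M *v (M *v a) = a"
proof -
  have "M ** matrix_inv M = mat 1 \<and> matrix_inv M ** M = mat 1"
    using assms unfolding invertible_def matrix_inv_def by (rule someI_ex)
  then show "M *v (matrix_inv M *v a) = a" "matrix_inv M *v (M *v a) = a"
    by (simp_all add: matrix_vector_mul_assoc)
qed

lemma symmetric_matrix_inner: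
  fixes M :: "real^'n^'n"
  assumes "transpose M = M"
  shows "x \<bullet> (M *v y) = y \<bullet> (M *v x)"
  by (metis dot_lmul_matrix inner_commute assms transpose_matrix_vector)

lemma invertible_positive_definite:
  fixes M :: "real^'n^'n"
  assumes "\<And>v. v \<noteq> 0 \<Longrightarrow> 0 < v \<bullet> (M *v v)"
  shows "invertible M"
proof -
  have "x = 0" if "M *v x = 0" for x
    using assms[of x] that by (cases "x = 0") auto
  then show ?thesis
    using matrix_left_invertible_ker[of M] invertible_left_inverse by blast
qed

text \<open>Expand \<open>0 \<le> (V - M\<^sup>-\<^sup>1 a) \<bullet> M (V - M\<^sup>-\<^sup>1 a)\<close>.  The lower bound involves \<open>M\<close> but not its inverse,
  and equality holds at \<open>V = M\<^sup>-\<^sup>1 a\<close>.  In the maximum principle below this replaces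
  \<open>|du|\<^sup>2\<close> by a function whose derivative does not involve derivatives of the inverse metric.\<close>

lemma dual_quadratic_form_lower_bound:
  fixes M :: "real^'n^'n"
  assumes sym: "transpose M = M" and pos: "\<And>v. v \<noteq> 0 \<Longrightarrow> 0 < v \<bullet> (M *v v)"
  shows "2 * (a \<bullet> V) - V \<bullet> (M *v V) \<le> a \<bullet> (matrix_inv M *v a)"
proof -
  define w where "w = matrix_inv M *v a"
  have Mw: "M *v w = a"
    unfolding w_def by (rule matrix_inv_vector) (rule invertible_positive_definite[OF pos])
  have "0 \<le> (V - w) \<bullet> (M *v (V - w))"
    using pos[of "V - w"] by (cases "V - w = 0") auto
  also have "\<dots> = V \<bullet> (M *v V) - 2 * (a \<bullet> V) + a \<bullet> w"
    using symmetric_matrix_inner[OF sym, of w V]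
    by (simp add: matrix_vector_mult_diff_distrib inner_diff_left inner_diff_right Mw inner_commute)
  finally show ?thesis by (simp add: w_def)
qed

lemma continuous_on_det:
  fixes M :: "'a::topological_space \<Rightarrow> real^'n^'n"
  assumes "\<And>i j. continuous_on S (\<lambda>y. M y $ i $ j)"
  shows "continuous_on S (\<lambda>y. det (M y))"
  unfolding det_def by (intro continuous_intros assms)

text \<open>Cramer's rule expresses the solution of a linear system as a quotient of polynomials in the data.\<close>

lemma continuous_on_matrix_inv_vector:
  fixes M :: "'a::topological_space \<Rightarrow> real^'n^'n"
  assumes M: "\<And>i j. continuous_on S (\<lambda>y. M y $ i $ j)" and a: "\<And>i. continuous_on S (\<lambda>y. a y $ i)"
    and inv: "\<And>y. y \<in> S \<Longrightarrow> invertible (M y)"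
  shows "continuous_on S (\<lambda>y. (matrix_inv (M y) *v a y) $ k)"
proof -
  have "continuous_on S (\<lambda>y. det (\<chi> i j. if j = k then a y $ i else M y $ i $ j) / det (M y))"
  proof (intro continuous_on_divide continuous_on_det ballI)
    show "continuous_on S (\<lambda>y. (\<chi> i j. if j = k then a y $ i else M y $ i $ j) $ i $ j)" for i j
      using M[of i j] a[of i] by (cases "j = k") simp_all
    show "det (M y) \<noteq> 0" if "y \<in> S" for y
      using inv[OF that] by (simp add: invertible_det_nz)
  qed (rule M)
  moreover have "(matrix_inv (M y) *v a y) $ k = det (\<chi> i j. if j = k then a y $ i else M y $ i $ j) / det (M y)"
    if "y \<in> S" for y
  proof -
    have "matrix_inv (M y) *v a y = (\<chi> k. det (\<chi> i j. if j = k then a y $ i else M y $ i $ j) / det (M y))"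
      using inv[OF that] by (intro cramer[THEN iffD1] matrix_inv_vector) (simp_all add: invertible_det_nz)
    then show ?thesis by simp
  qed
  ultimately show ?thesis by (simp cong: continuous_on_cong)
qed

locale riemannian_atlas = smooth_atlas X \<A> for X :: "'m topology" and \<A> :: "('m, 'n::finite) chart set" +
  fixes g :: "('m, 'n) metric"
  assumes metric: "riemannian_metric X \<A> g"
begin

lemma metric_bilinear: "x \<in> topspace X \<Longrightarrow> symmetric_bilinear \<A> x (g x)"
  and metric_pos: "x \<in> topspace X \<Longrightarrow> v \<in> tangent_space \<A> x \<Longrightarrow> v \<noteq> (\<lambda>_. 0) \<Longrightarrow> 0 < g x v v"
  and metric_smooth: "c \<in> \<A> \<Longrightarrow> smooth_on (\<lambda>y. metric_matrix \<A> g c y $ i $ j) (chart_image c)"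
  using metric unfolding riemannian_metric_def by blast+

lemma charts_at_topspace: "c \<in> charts_at \<A> x \<Longrightarrow> x \<in> topspace X"
  using charts_atD chart_domain_subset by blast

lemma metric_matrix_at:
  "c \<in> charts_at \<A> x \<Longrightarrow> metric_matrix \<A> g c (snd c x) = tensor_matrix \<A> c x (g x)"
  by (simp add: metric_matrix_def chart_inv_chart[OF charts_atD])

lemma metric_components:
  assumes c: "c \<in> charts_at \<A> x" and "v \<in> tangent_space \<A> x" "w \<in> tangent_space \<A> x"
  shows "g x v w = v c \<bullet> (metric_matrix \<A> g c (snd c x) *v w c)"
  unfolding metric_matrix_at[OF c]
  by (rule symmetric_bilinear_expansion[OF c metric_bilinear[OF charts_at_topspace[OF c]] assms(2,3)])

lemma metric_matrix_sym_at:
  assumes "c \<in> charts_at \<A> x"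
  shows "transpose (metric_matrix \<A> g c (snd c x)) = metric_matrix \<A> g c (snd c x)"
  unfolding metric_matrix_at[OF assms]
  by (rule tensor_matrix_symmetric[OF assms metric_bilinear[OF charts_at_topspace[OF assms]]])

lemma metric_matrix_pos_at:
  assumes c: "c \<in> charts_at \<A> x" and "\<xi> \<noteq> 0"
  shows "0 < \<xi> \<bullet> (metric_matrix \<A> g c (snd c x) *v \<xi>)"
proof -
  obtain v where v: "v \<in> tangent_space \<A> x" "v c = \<xi>"
    by (rule tangent_vector_with_components[OF c])
  then have "v \<noteq> (\<lambda>_. 0)" using \<open>\<xi> \<noteq> 0\<close> by auto
  from metric_pos[OF charts_at_topspace[OF c] v(1) this] show ?thesis
    by (simp only: metric_components[OF c v(1) v(1)] v(2))
qed

context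
  fixes c y assumes c: "c \<in> \<A>" and y: "y \<in> chart_image c"
begin

lemma metric_matrix_sym: "transpose (metric_matrix \<A> g c y) = metric_matrix \<A> g c y"
  using metric_matrix_sym_at[OF in_charts_at_inv[OF c y]] by (simp only: chart_chart_inv[OF c y])

lemma metric_matrix_pos: "\<xi> \<noteq> 0 \<Longrightarrow> 0 < \<xi> \<bullet> (metric_matrix \<A> g c y *v \<xi>)"
  using metric_matrix_pos_at[OF in_charts_at_inv[OF c y]] by (simp only: chart_chart_inv[OF c y])

lemma metric_matrix_invertible: "invertible (metric_matrix \<A> g c y)"
  by (rule invertible_positive_definite) (rule metric_matrix_pos)

lemma metric_matrix_differentiable: "(\<lambda>y. metric_matrix \<A> g c y $ i $ j) differentiable at y"
proof -
  have "Ck_on (Suc 0) (\<lambda>y. metric_matrix \<A> g c y $ i $ j) (chart_image c)"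
    using metric_smooth[OF c] unfolding smooth_on_def by blast
  then show ?thesis using y by simp
qed

end

text \<open>The norm of a covector is defined in one chosen chart; this computes it in any chart.  Let \<open>v\<close> be
  the tangent vector that represents \<open>\<alpha>\<close> through the metric.  In every chart its components are
  \<open>G\<^sup>-\<^sup>1 a\<close>, where \<open>a\<close> are the components of \<open>\<alpha>\<close> there, so the quadratic form always has the value
  \<open>\<alpha>(v)\<close>, which does not refer to a chart.\<close>

lemma covec_norm_sq:
  assumes c: "c \<in> charts_at \<A> x" and \<alpha>: "\<alpha> \<in> cotangent_space \<A> x"
  defines "a \<equiv> \<chi> i. snd \<alpha> (coord_vec \<A> c x i)"
  shows "(covec_norm \<A> g \<alpha>)\<^sup>2 = a \<bullet> (matrix_inv (metric_matrix \<A> g c (snd c x)) *v a)"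
proof -
  define q where "q = (\<lambda>d. (\<chi> i. snd \<alpha> (coord_vec \<A> d x i)) \<bullet>
      (matrix_inv (metric_matrix \<A> g d (snd d x)) *v (\<chi> i. snd \<alpha> (coord_vec \<A> d x i))))"
  have lin: "tangent_linear \<A> x (snd \<alpha>)" and fst: "fst \<alpha> = x"
    using \<alpha> by (auto simp: cotangent_space_def)
  have comp: "snd \<alpha> w = (\<chi> i. snd \<alpha> (coord_vec \<A> d x i)) \<bullet> w d"
    if "w \<in> tangent_space \<A> x" "d \<in> charts_at \<A> x" for w d
    using tangent_linear_expansion[OF that(2,1) lin] by (simp add: inner_vec_def mult.commute)
  obtain v where v: "v \<in> tangent_space \<A> x"
    "v c = matrix_inv (metric_matrix \<A> g c (snd c x)) *v a"
    by (rule tangent_vector_with_components[OF c])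
  have inv: "invertible (metric_matrix \<A> g d (snd d x))" if "d \<in> charts_at \<A> x" for d
    by (rule invertible_positive_definite) (rule metric_matrix_pos_at[OF that])
  have riesz: "g x w v = snd \<alpha> w" if "w \<in> tangent_space \<A> x" for w
    unfolding metric_components[OF c that v(1)] v(2) matrix_inv_vector(1)[OF inv[OF c]] comp[OF that c] a_def
    by (rule inner_commute)
  have q: "q d = snd \<alpha> v" if d: "d \<in> charts_at \<A> x" for d
  proof -
    have "metric_matrix \<A> g d (snd d x) *v v d = (\<chi> i. snd \<alpha> (coord_vec \<A> d x i))"
    proof -
      have "(metric_matrix \<A> g d (snd d x) *v v d) $ i = snd \<alpha> (coord_vec \<A> d x i)" for i
        using riesz[OF coord_vec_tangent[OF d, of i]]
          metric_components[OF d coord_vec_tangent[OF d, of i] v(1)]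
        by (simp add: coord_vec_self[OF d] inner_axis' )
      then show ?thesis by (simp add: vec_eq_iff)
    qed
    then have "matrix_inv (metric_matrix \<A> g d (snd d x)) *v (\<chi> i. snd \<alpha> (coord_vec \<A> d x i)) = v d"
      using matrix_inv_vector(2)[OF inv[OF d]] by metis
    then show ?thesis unfolding q_def comp[OF v(1) d] by simp
  qed
  let ?e = "chart_at \<A> x"
  have e: "?e \<in> charts_at \<A> x" by (rule chart_at_in[OF charts_at_topspace[OF c]])
  have "covec_norm \<A> g \<alpha> = sqrt (q ?e)"
    by (simp add: covec_norm_def Let_def fst q_def inner_vec_def matrix_vector_mult_def sum_distrib_left ac_simps)
  moreover have "0 \<le> q ?e"
    unfolding q[OF e] riesz[OF v(1), symmetric]
    using metric_pos[OF charts_at_topspace[OF c] v(1)] metric_components[OF c v(1) v(1)]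
    by (cases "v = (\<lambda>_. 0)") auto
  ultimately have "(covec_norm \<A> g \<alpha>)\<^sup>2 = q ?e" by simp
  also have "\<dots> = q c" using q[OF e] q[OF c] by simp
  finally show ?thesis by (simp add: q_def a_def)
qed

lemma Ck3_derivatives:
  assumes u: "Ck_manifold \<A> 3 u" and c: "c \<in> \<A>" and y: "y \<in> chart_image c"
  shows "(u \<circ> chart_inv c) differentiable at y"
    and "pderiv_at i (u \<circ> chart_inv c) differentiable at y"
    and "pderiv_at i (pderiv_at j (u \<circ> chart_inv c)) y = pderiv_at j (pderiv_at i (u \<circ> chart_inv c)) y"
proof -
  have Ck: "Ck_on (Suc (Suc (Suc 0))) (u \<circ> chart_inv c) (chart_image c)"
    using u c by (simp add: Ck_manifold_def numeral_3_eq_3)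
  then show "(u \<circ> chart_inv c) differentiable at y"
    using y by simp
  show "pderiv_at i (u \<circ> chart_inv c) differentiable at y"
    using Ck y unfolding pderiv_at_def[abs_def] by simp
  have "continuous_on (chart_image c)
      (\<lambda>x. frechet_derivative (\<lambda>z. frechet_derivative (u \<circ> chart_inv c) (at z) v) (at x) w)" for v w
    using Ck by (intro differentiable_imp_continuous_on)
      (simp add: differentiable_on_def differentiable_at_withinI)
  then have "Ck_on 2 (u \<circ> chart_inv c) (chart_image c)"
    using Ck by (simp add: numeral_2_eq_2)
  from mixed_derivatives_commute[OF open_chart_image[OF c] y this]
  show "pderiv_at i (pderiv_at j (u \<circ> chart_inv c)) y = pderiv_at j (pderiv_at i (u \<circ> chart_inv c)) y"
    unfolding pderiv_at_def[abs_def] .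
qed

lemma differential_components:
  assumes u: "Ck_manifold \<A> 3 u" and c: "c \<in> charts_at \<A> x"
  shows "snd (differential \<A> u x) (coord_vec \<A> c x i) = pderiv_at i (u \<circ> chart_inv c) (snd c x)"
proof -
  let ?e = "chart_at \<A> x"
  have e: "?e \<in> charts_at \<A> x" by (rule chart_at_in[OF charts_at_topspace[OF c]])
  have "(u \<circ> chart_inv ?e) differentiable at (snd ?e x)"
    using Ck3_derivatives(1)[OF u charts_atD(1)[OF e] chart_in_image[OF charts_atD[OF e]]] .
  from change_of_chart[OF c e this] show ?thesis
    using coord_vec_tangent[OF c, of i] e
    by (simp add: differential_def Let_def pderiv_at_def coord_vec_def)
qed

lemma differential_cotangent:
  assumes u: "Ck_manifold \<A> 3 u" and x: "x \<in> topspace X"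
  shows "differential \<A> u x \<in> cotangent_space \<A> x"
proof -
  let ?e = "chart_at \<A> x"
  have e: "?e \<in> charts_at \<A> x" by (rule chart_at_in[OF x])
  have lin: "linear (frechet_derivative (u \<circ> chart_inv ?e) (at (snd ?e x)))"
    by (intro linear_frechet_derivative Ck3_derivatives(1)[OF u charts_atD(1)[OF e]]
        chart_in_image[OF charts_atD[OF e]])
  have "tangent_linear \<A> x (\<lambda>v\<in>tangent_space \<A> x. frechet_derivative (u \<circ> chart_inv ?e) (at (snd ?e x)) (v ?e))"
    unfolding tangent_linear_def
    using tangent_space_lincomb by (simp add: linear_add[OF lin] linear_cmul[OF lin])
  then show ?thesis
    by (simp add: differential_def cotangent_space_def Let_def)
qed

abbreviation coord_grad :: "('m, 'n) chart \<Rightarrow> ('m \<Rightarrow> real) \<Rightarrow> real^'n \<Rightarrow> real^'n" where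
  "coord_grad c u y \<equiv> \<chi> i. pderiv_at i (u \<circ> chart_inv c) y"

lemma gradient_norm_sq:
  assumes "Ck_manifold \<A> 3 u" "c \<in> charts_at \<A> x"
  shows "(covec_norm \<A> g (differential \<A> u x))\<^sup>2 =
    coord_grad c u (snd c x) \<bullet> (matrix_inv (metric_matrix \<A> g c (snd c x)) *v coord_grad c u (snd c x))"
  using covec_norm_sq[OF assms(2) differential_cotangent[OF assms(1) charts_at_topspace[OF assms(2)]]]
  by (simp only: differential_components[OF assms])

lemma continuous_map_Ck3:
  assumes "Ck_manifold \<A> 3 u"
  shows "continuous_map X euclideanreal u"
proof (rule continuous_map_from_charts)
  fix c assume "c \<in> \<A>"
  then show "continuous_on (chart_image c) (u \<circ> chart_inv c)"
    using Ck3_derivatives(1)[OF assms]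
    by (intro differentiable_imp_continuous_on) (simp add: differentiable_on_def differentiable_at_withinI)
qed

lemma continuous_map_gradient_norm_sq:
  assumes u: "Ck_manifold \<A> 3 u"
  shows "continuous_map X euclideanreal (\<lambda>x. (covec_norm \<A> g (differential \<A> u x))\<^sup>2)"
proof (rule continuous_map_from_charts)
  fix c assume c: "c \<in> \<A>"
  let ?q = "\<lambda>y. \<Sum>k\<in>UNIV. coord_grad c u y $ k * (matrix_inv (metric_matrix \<A> g c y) *v coord_grad c u y) $ k"
  have grad: "continuous_on (chart_image c) (\<lambda>y. coord_grad c u y $ i)" for i
    using Ck3_derivatives(2)[OF u c]
    by (intro differentiable_imp_continuous_on) (simp add: differentiable_on_def differentiable_at_withinI)
  have met: "continuous_on (chart_image c) (\<lambda>y. metric_matrix \<A> g c y $ i $ j)" for i j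
    using metric_matrix_differentiable[OF c]
    by (intro differentiable_imp_continuous_on) (simp add: differentiable_on_def differentiable_at_withinI)
  have "continuous_on (chart_image c) ?q"
    by (intro continuous_on_sum continuous_on_mult grad continuous_on_matrix_inv_vector met
        metric_matrix_invertible[OF c])
  moreover have "?q y = ((\<lambda>x. (covec_norm \<A> g (differential \<A> u x))\<^sup>2) \<circ> chart_inv c) y" if y: "y \<in> chart_image c" for y
    using gradient_norm_sq[OF u in_charts_at_inv[OF c y]]
    by (simp add: chart_chart_inv[OF c y] inner_vec_def)
  ultimately show "continuous_on (chart_image c) ((\<lambda>x. (covec_norm \<A> g (differential \<A> u x))\<^sup>2) \<circ> chart_inv c)"
    using continuous_on_cong[of "chart_image c" "chart_image c" ?q] by blast
qed

text \<open>The Levi-Civita connection has no torsion.\<close>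

lemma christoffel_symmetric:
  assumes c: "c \<in> \<A>" and y: "y \<in> chart_image c"
  shows "christoffel \<A> g c y k i j = christoffel \<A> g c y k j i"
proof -
  have "pderiv_at l (\<lambda>z. metric_matrix \<A> g c z $ i $ j) y = pderiv_at l (\<lambda>z. metric_matrix \<A> g c z $ j $ i) y" for l i j
  proof -
    have "metric_matrix \<A> g c z $ i $ j = metric_matrix \<A> g c z $ j $ i" if "z \<in> chart_image c" for z
      using arg_cong[OF metric_matrix_sym[OF c that], of "\<lambda>M. M $ j $ i"] by (simp add: transpose_def)
    from frechet_derivative_cong_open[OF open_chart_image[OF c] y this]
    show ?thesis by (simp add: pderiv_at_def)
  qed
  from this[of _ i j] show ?thesis
    unfolding christoffel_def by (simp add: add.commute)
qed

text \<open>Symmetry combines the symmetry of second derivatives with that of the Christoffel symbols.\<close>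

lemma hessian_bilinear:
  assumes u: "Ck_manifold \<A> 3 u" and x: "x \<in> topspace X"
  shows "symmetric_bilinear \<A> x (hessian \<A> g u x)"
proof -
  let ?e = "chart_at \<A> x"
  have e: "?e \<in> charts_at \<A> x" by (rule chart_at_in[OF x])
  note eA = charts_atD(1)[OF e] chart_in_image[OF charts_atD[OF e]]
  define H where "H = (\<lambda>i j. pderiv_at i (pderiv_at j (u \<circ> chart_inv ?e)) (snd ?e x)
    - (\<Sum>k\<in>UNIV. christoffel \<A> g ?e (snd ?e x) k i j * pderiv_at k (u \<circ> chart_inv ?e) (snd ?e x)))"
  have hess: "hessian \<A> g u x v w = (\<Sum>i\<in>UNIV. \<Sum>j\<in>UNIV. H i j * v ?e $ i * w ?e $ j)" for v w
    by (simp add: hessian_def Let_def H_def)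
  have H: "H i j = H j i" for i j
    unfolding H_def christoffel_symmetric[OF eA, of _ i j] Ck3_derivatives(3)[OF u eA, of i j] ..
  have "hessian \<A> g u x v w = hessian \<A> g u x w v" for v w
    unfolding hess by (subst sum.swap, intro sum.cong refl, subst H) (simp add: ac_simps)
  moreover have "tangent_linear \<A> x (\<lambda>v. hessian \<A> g u x v w)" for w
    unfolding tangent_linear_def hess
    by (simp add: algebra_simps sum.distrib sum_distrib_left)
  ultimately show ?thesis by (simp add: symmetric_bilinear_def)
qed

end

section \<open>The Hessian along the gradient and the maximum principle\<close>

lemma directional_derivative_at_0:
  fixes h :: "real^'n \<Rightarrow> real"
  assumes "h differentiable at y"
  shows "((\<lambda>s. h (y + s *\<^sub>R V)) has_real_derivative (\<Sum>j\<in>UNIV. V $ j * pderiv_at j h y)) (at 0)"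
  using has_real_derivative_along_line[of h y 0 V] frechet_derivative_sum_axis[of h y V] assms
  by (simp add: pderiv_at_def)

context riemannian_atlas
begin

text \<open>In coordinates, \<open>V\<close> is the gradient of \<open>u\<close>, so contracting the Christoffel symbols with \<open>du\<close>
  cancels the inverse metric against it.  After a further contraction with \<open>V\<close> twice, the three
  derivatives of the metric in the Christoffel symbols give the same sum up to sign, and one half of
  it remains.  The right-hand side is the derivative at \<open>y\<close>, in the direction \<open>V\<close>, of the
  function \<open>z \<mapsto> 2 du\<^sub>z(V) - g\<^sub>z(V, V)\<close> with \<open>V\<close> held constant in the chart.\<close>

lemma hessian_along_gradient:
  assumes u: "Ck_manifold \<A> 3 u" and x: "x \<in> topspace X"
  defines "c \<equiv> chart_at \<A> x"
  defines "y \<equiv> snd c x"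
  defines "V \<equiv> matrix_inv (metric_matrix \<A> g c y) *v coord_grad c u y"
  assumes v: "v c = V"
  shows "2 * hessian \<A> g u x v v =
    2 * (\<Sum>i\<in>UNIV. V $ i * (\<Sum>j\<in>UNIV. V $ j * pderiv_at j (pderiv_at i (u \<circ> chart_inv c)) y))
    - (\<Sum>j\<in>UNIV. \<Sum>l\<in>UNIV. V $ j * V $ l *
        (\<Sum>i\<in>UNIV. V $ i * pderiv_at i (\<lambda>z. metric_matrix \<A> g c z $ j $ l) y))"
proof -
  have c: "c \<in> charts_at \<A> x" unfolding c_def by (rule chart_at_in[OF x])
  note cA = charts_atD(1)[OF c] chart_in_image[OF charts_atD[OF c]]
  define G where "G = metric_matrix \<A> g c y"
  define a where "a = coord_grad c u y"
  define T where "T = (\<lambda>i j l. pderiv_at i (\<lambda>z. metric_matrix \<A> g c z $ j $ l) y)"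
  define P where "P = (\<lambda>i j l. V $ i * V $ j * V $ l * T i j l)"
  define D where "D = (\<lambda>i j. pderiv_at i (pderiv_at j (u \<circ> chart_inv c)) y)"
  have V: "V = matrix_inv G *v a" by (simp add: V_def G_def a_def)
  have inv_sym: "matrix_inv G $ k $ l = matrix_inv G $ l $ k" for k l
  proof -
    have inv: "invertible G" unfolding G_def y_def by (rule metric_matrix_invertible[OF cA])
    have sym: "transpose G = G" unfolding G_def y_def by (rule metric_matrix_sym[OF cA])
    have "x \<bullet> (matrix_inv G *v z) = z \<bullet> (matrix_inv G *v x)" for x z
      using symmetric_matrix_inner[OF sym, of "matrix_inv G *v x" "matrix_inv G *v z"]
      by (simp add: matrix_inv_vector[OF inv] inner_commute)
    from this[of "axis k 1" "axis l 1"] show ?thesis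
      by (simp add: inner_axis' matrix_vector_mult_basis column_def)
  qed
  have chr: "(\<Sum>k\<in>UNIV. christoffel \<A> g c y k i j * a $ k) = (\<Sum>l\<in>UNIV. V $ l * (T i j l + T j i l - T l i j)) / 2" for i j
  proof -
    have "christoffel \<A> g c y k i j = (\<Sum>l\<in>UNIV. matrix_inv G $ l $ k * (T i j l + T j i l - T l i j)) / 2" for k
      unfolding christoffel_def G_def[symmetric] T_def inv_sym[of k] ..
    then have "(\<Sum>k\<in>UNIV. christoffel \<A> g c y k i j * a $ k) =
       (\<Sum>k\<in>UNIV. \<Sum>l\<in>UNIV. matrix_inv G $ l $ k * a $ k * (T i j l + T j i l - T l i j)) / 2"
      by (simp add: sum_divide_distrib sum_distrib_left sum_distrib_right ac_simps)
    also have "\<dots> = (\<Sum>l\<in>UNIV. V $ l * (T i j l + T j i l - T l i j)) / 2"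
      by (subst sum.swap) (simp add: V matrix_vector_mult_def sum_distrib_right)
    finally show ?thesis .
  qed
  have "hessian \<A> g u x v v = (\<Sum>i\<in>UNIV. \<Sum>j\<in>UNIV.
      (D i j - (\<Sum>k\<in>UNIV. christoffel \<A> g c y k i j * a $ k)) * V $ i * V $ j)"
    by (simp add: hessian_def Let_def c_def[symmetric] y_def[symmetric] v D_def a_def)
  also have "\<dots> = (\<Sum>i\<in>UNIV. \<Sum>j\<in>UNIV. V $ i * (V $ j * D j i) -
      (\<Sum>l\<in>UNIV. P i j l + P j i l - P l i j) / 2)"
  proof (intro sum.cong refl)
    fix i j
    have "D i j = D j i"
      unfolding D_def y_def by (rule Ck3_derivatives(3)[OF u cA])
    moreover have "(\<Sum>l\<in>UNIV. V $ l * (T i j l + T j i l - T l i j)) / 2 * V $ i * V $ j =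
        (\<Sum>l\<in>UNIV. P i j l + P j i l - P l i j) / 2"
      by (simp add: P_def sum_divide_distrib sum_distrib_left sum_distrib_right algebra_simps)
    ultimately show "(D i j - (\<Sum>k\<in>UNIV. christoffel \<A> g c y k i j * a $ k)) * V $ i * V $ j =
        V $ i * (V $ j * D j i) - (\<Sum>l\<in>UNIV. P i j l + P j i l - P l i j) / 2"
      unfolding chr by (simp add: algebra_simps)
  qed
  also have "\<dots> = (\<Sum>i\<in>UNIV. \<Sum>j\<in>UNIV. V $ i * (V $ j * D j i)) -
      ((\<Sum>i\<in>UNIV. \<Sum>j\<in>UNIV. \<Sum>l\<in>UNIV. P i j l) + (\<Sum>i\<in>UNIV. \<Sum>j\<in>UNIV. \<Sum>l\<in>UNIV. P j i l)
        - (\<Sum>i\<in>UNIV. \<Sum>j\<in>UNIV. \<Sum>l\<in>UNIV. P l i j)) / 2"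
    by (simp add: sum_subtractf sum.distrib sum_divide_distrib[symmetric])
  also have "(\<Sum>i\<in>UNIV. \<Sum>j\<in>UNIV. \<Sum>l\<in>UNIV. P j i l) = (\<Sum>i\<in>UNIV. \<Sum>j\<in>UNIV. \<Sum>l\<in>UNIV. P i j l)"
    by (rule sum.swap)
  also have "(\<Sum>i\<in>UNIV. \<Sum>j\<in>UNIV. \<Sum>l\<in>UNIV. P i j l) = (\<Sum>j\<in>UNIV. \<Sum>l\<in>UNIV. \<Sum>i\<in>UNIV. P i j l)"
    by (subst sum.swap) (intro sum.cong refl sum.swap)
  finally have "2 * hessian \<A> g u x v v = 2 * (\<Sum>i\<in>UNIV. \<Sum>j\<in>UNIV. V $ i * (V $ j * D j i)) -
      (\<Sum>j\<in>UNIV. \<Sum>l\<in>UNIV. \<Sum>i\<in>UNIV. P i j l)"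
    by simp
  also have "(\<Sum>j\<in>UNIV. \<Sum>l\<in>UNIV. \<Sum>i\<in>UNIV. P i j l) =
      (\<Sum>j\<in>UNIV. \<Sum>l\<in>UNIV. V $ j * V $ l * (\<Sum>i\<in>UNIV. V $ i * T i j l))"
    by (intro sum.cong refl) (simp add: P_def sum_distrib_left ac_simps)
  finally show ?thesis
    by (simp add: D_def T_def sum_distrib_left)
qed

text \<open>With \<open>V\<close> the gradient at \<open>x\<close>, extended to have constant components in a chart, the function
  \<open>L = 2 du(V) - g(V, V)\<close> is at most \<open>|du|\<^sup>2\<close>, with equality at \<open>x\<close>.  So
  \<open>(1 + L) exp (2 \<beta> u)\<close> has a local maximum at \<open>x\<close> too.  Write \<open>Q = |du|\<^sup>2\<close> at \<open>x\<close>.  There the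
  derivative of \<open>u\<close> along \<open>V\<close> is \<open>Q\<close>, and that of \<open>L\<close> is \<open>2 \<nabla>\<^sup>2u(V, V)\<close>; hence
  \<open>\<nabla>\<^sup>2u(V, V) = - \<beta> (1 + Q) Q\<close>.  But the Hessian bound gives at least \<open>- B (1 + Q) Q\<close>, and \<open>B < \<beta>\<close>
  leaves only \<open>Q = 0\<close>.\<close>

lemma gradient_vanishes_at_maximum:
  assumes u: "Ck_manifold \<A> 3 u" and x: "x \<in> topspace X"
    and hess: "\<And>v. v \<in> tangent_space \<A> x \<Longrightarrow>
      - B * ((covec_norm \<A> g (differential \<A> u x))\<^sup>2 + 1) * g x v v \<le> hessian \<A> g u x v v"
    and "B < \<beta>"
    and max: "\<And>z. z \<in> topspace X \<Longrightarrow>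
      (1 + (covec_norm \<A> g (differential \<A> u z))\<^sup>2) * exp (2 * \<beta> * u z) \<le>
      (1 + (covec_norm \<A> g (differential \<A> u x))\<^sup>2) * exp (2 * \<beta> * u x)"
  shows "(covec_norm \<A> g (differential \<A> u x))\<^sup>2 = 0"
proof -
  define c where "c = chart_at \<A> x"
  define y where "y = snd c x"
  have c: "c \<in> charts_at \<A> x" unfolding c_def by (rule chart_at_in[OF x])
  note cA = charts_atD(1)[OF c]
  have y: "y \<in> chart_image c" unfolding y_def by (rule chart_in_image[OF charts_atD[OF c]])
  define f where "f = u \<circ> chart_inv c"
  define V where "V = matrix_inv (metric_matrix \<A> g c y) *v coord_grad c u y"
  define Q where "Q = (covec_norm \<A> g (differential \<A> u x))\<^sup>2"
  have GV: "metric_matrix \<A> g c y *v V = coord_grad c u y"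
    unfolding V_def by (rule matrix_inv_vector(1)[OF metric_matrix_invertible[OF cA y]])
  have Q: "Q = coord_grad c u y \<bullet> V"
    unfolding Q_def V_def y_def by (rule gradient_norm_sq[OF u c])
  obtain v where v: "v \<in> tangent_space \<A> x" "v c = V"
    by (rule tangent_vector_with_components[OF c])
  have gvv: "g x v v = Q"
    using metric_components[OF c v(1) v(1)] unfolding v(2) y_def[symmetric] GV Q by (simp add: inner_commute)
  define L where "L = (\<lambda>z. 2 * (\<Sum>i\<in>UNIV. V $ i * pderiv_at i f z)
      - (\<Sum>j\<in>UNIV. \<Sum>l\<in>UNIV. V $ j * V $ l * metric_matrix \<A> g c z $ j $ l))"
  have L: "L z = 2 * (coord_grad c u z \<bullet> V) - V \<bullet> (metric_matrix \<A> g c z *v V)" for z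
    by (simp add: L_def f_def inner_vec_def matrix_vector_mult_def sum_distrib_left ac_simps)
  have Ly: "L y = Q"
    unfolding L GV Q by (simp add: inner_commute)
  have Lle: "L z \<le> (covec_norm \<A> g (differential \<A> u (chart_inv c z)))\<^sup>2" if z: "z \<in> chart_image c" for z
    unfolding L gradient_norm_sq[OF u in_charts_at_inv[OF cA z]] chart_chart_inv[OF cA z]
    by (rule dual_quadratic_form_lower_bound[OF metric_matrix_sym[OF cA z] metric_matrix_pos[OF cA z]])
  define L' where "L' = 2 * (\<Sum>i\<in>UNIV. V $ i * (\<Sum>j\<in>UNIV. V $ j * pderiv_at j (pderiv_at i f) y))
    - (\<Sum>j\<in>UNIV. \<Sum>l\<in>UNIV. V $ j * V $ l *
        (\<Sum>i\<in>UNIV. V $ i * pderiv_at i (\<lambda>z. metric_matrix \<A> g c z $ j $ l) y))"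
  have L'_hess: "L' = 2 * hessian \<A> g u x v v"
    unfolding L'_def f_def
    by (rule hessian_along_gradient[OF u x, of v, folded c_def, folded y_def, folded V_def, OF v(2), symmetric])
  have dL: "((\<lambda>s. L (y + s *\<^sub>R V)) has_real_derivative L') (at 0)"
    unfolding L_def L'_def
  proof (intro DERIV_diff DERIV_cmult DERIV_sum)
    show "((\<lambda>s. pderiv_at i f (y + s *\<^sub>R V)) has_real_derivative
        (\<Sum>j\<in>UNIV. V $ j * pderiv_at j (pderiv_at i f) y)) (at 0)" for i
      using Ck3_derivatives(2)[OF u cA y] unfolding f_def by (rule directional_derivative_at_0)
    show "((\<lambda>s. metric_matrix \<A> g c (y + s *\<^sub>R V) $ j $ l) has_real_derivative
        (\<Sum>i\<in>UNIV. V $ i * pderiv_at i (\<lambda>z. metric_matrix \<A> g c z $ j $ l) y)) (at 0)" for j l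
      using metric_matrix_differentiable[OF cA y] by (rule directional_derivative_at_0)
  qed
  have df: "((\<lambda>s. f (y + s *\<^sub>R V)) has_real_derivative Q) (at 0)"
  proof -
    have "Q = (\<Sum>j\<in>UNIV. V $ j * pderiv_at j f y)"
      unfolding Q by (simp add: inner_vec_def f_def mult.commute)
    then show ?thesis
      using directional_derivative_at_0[OF Ck3_derivatives(1)[OF u cA y], of V] by (simp add: f_def)
  qed
  have fy: "f y = u x" by (simp add: f_def y_def chart_inv_chart[OF charts_atD[OF c]])
  define \<psi> where "\<psi> = (\<lambda>s. (1 + L (y + s *\<^sub>R V)) * exp (2 * \<beta> * f (y + s *\<^sub>R V)))"
  have d\<psi>: "(\<psi> has_real_derivative (L' + (1 + Q) * (2 * \<beta> * Q)) * exp (2 * \<beta> * f y)) (at 0)"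
    unfolding \<psi>_def
    by (rule derivative_eq_intros dL df refl | simp add: Ly algebra_simps)+
  obtain d where d: "d > 0" "ball y d \<subseteq> chart_image c"
    using open_chart_image[OF cA] y openE by blast
  \<comment> \<open>For \<open>|s| < \<delta>\<close> the segment from \<open>y\<close> to \<open>y + s V\<close> stays in the image of the chart.\<close>
  define \<delta> where "\<delta> = d / (norm V + 1)"
  have "\<delta> > 0" using d(1) by (simp add: \<delta>_def add_nonneg_pos)
  have "\<psi> s \<le> \<psi> 0" if "\<bar>0 - s\<bar> < \<delta>" for s
  proof -
    have "\<bar>s\<bar> * norm V \<le> \<bar>s\<bar> * (norm V + 1)" by (intro mult_left_mono) auto
    also have "\<dots> < \<delta> * (norm V + 1)" using that by (intro mult_strict_right_mono) (auto simp: add_nonneg_pos)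
    also have "\<dots> = d" using add_nonneg_pos[of "norm V" 1] by (simp add: \<delta>_def)
    finally have z: "y + s *\<^sub>R V \<in> chart_image c" (is "?z \<in> _")
      using d(2) by (auto simp: dist_norm subset_eq)
    let ?w = "chart_inv c ?z"
    have "\<psi> s \<le> (1 + (covec_norm \<A> g (differential \<A> u ?w))\<^sup>2) * exp (2 * \<beta> * u ?w)"
      unfolding \<psi>_def f_def using Lle[OF z] by simp
    also have "\<dots> \<le> (1 + Q) * exp (2 * \<beta> * u x)"
      unfolding Q_def by (rule max) (rule chart_domain_subset[OF cA chart_inv_in[OF cA z]])
    also have "\<dots> = \<psi> 0"
      by (simp add: \<psi>_def Ly fy)
    finally show ?thesis .
  qed
  then have "(L' + (1 + Q) * (2 * \<beta> * Q)) * exp (2 * \<beta> * f y) = 0"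
    using DERIV_local_max[OF d\<psi> \<open>\<delta> > 0\<close>] by blast
  then have "L' + (1 + Q) * (2 * \<beta> * Q) = 0" by simp
  then have "L' = - (1 + Q) * (2 * \<beta> * Q)" by (simp add: algebra_simps eq_neg_iff_add_eq_0)
  moreover have "- B * (Q + 1) * Q \<le> L' / 2"
    using hess[OF v(1)] unfolding gvv L'_hess Q_def[symmetric] by simp
  ultimately have "(\<beta> - B) * ((Q + 1) * Q) \<le> 0"
    by (simp add: algebra_simps)
  moreover have "0 \<le> Q" by (simp add: Q_def)
  ultimately have "(Q + 1) * Q \<le> 0"
    using \<open>B < \<beta>\<close> by (simp add: mult_le_0_iff)
  then show ?thesis using \<open>0 \<le> Q\<close> unfolding Q_def[symmetric] by (simp add: mult_le_0_iff)
qed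

text \<open>At a maximum point \<open>z\<close> of \<open>(1 + |du|\<^sup>2) exp (2 (B + 1) u)\<close> the differential vanishes.  Comparing
  the value of this function at \<open>x\<close> with its value at \<open>z\<close> gives
  \<open>1 + |du|\<^sup>2 \<le> exp (2 (B + 1) (u z - u x))\<close> at \<open>x\<close>, and \<open>u z - u x \<le> 2 K\<close>.\<close>

lemma gradient_bound_of_hessian_bound:
  assumes "compact_space X" "x \<in> topspace X" and u: "Ck_manifold \<A> 3 u"
    and "0 \<le> B"
    and hess: "\<And>x v. x \<in> topspace X \<Longrightarrow> v \<in> tangent_space \<A> x \<Longrightarrow>
      - B * ((covec_norm \<A> g (differential \<A> u x))\<^sup>2 + 1) * g x v v \<le> hessian \<A> g u x v v"
    and K: "\<And>x. x \<in> topspace X \<Longrightarrow> \<bar>u x\<bar> \<le> K"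
  shows "covec_norm \<A> g (differential \<A> u x) \<le> exp (2 * (B + 1) * K)"
proof -
  let ?Q = "\<lambda>x. (covec_norm \<A> g (differential \<A> u x))\<^sup>2"
  define \<Phi> where "\<Phi> = (\<lambda>x. (1 + ?Q x) * exp (2 * (B + 1) * u x))"
  have "continuous_map X euclideanreal \<Phi>"
    unfolding \<Phi>_def
    by (intro continuous_map_real_mult continuous_map_add continuous_map_gradient_norm_sq[OF u]
        continuous_map_compose[OF continuous_map_real_mult[OF _ continuous_map_Ck3[OF u]], where g = exp, unfolded comp_def])
      (auto intro: continuous_intros)
  then have "compact (\<Phi> ` topspace X)"
    using \<open>compact_space X\<close> image_compactin[of X "topspace X" euclideanreal \<Phi>] by (simp add: compact_space_def)
  moreover have "\<Phi> ` topspace X \<noteq> {}" using \<open>x \<in> topspace X\<close> by blast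
  ultimately obtain z where z: "z \<in> topspace X" "\<And>x. x \<in> topspace X \<Longrightarrow> \<Phi> x \<le> \<Phi> z"
    using compact_attains_sup[of "\<Phi> ` topspace X"] by blast
  have "?Q z = 0"
    by (rule gradient_vanishes_at_maximum[OF u z(1) hess[OF z(1)], of "B + 1"])
      (use z(2) in \<open>auto simp: \<Phi>_def\<close>)
  then have "(1 + ?Q x) * exp (2 * (B + 1) * u x) \<le> exp (2 * (B + 1) * u z)"
    using z(2)[OF \<open>x \<in> topspace X\<close>] by (simp add: \<Phi>_def)
  then have "1 + ?Q x \<le> exp (2 * (B + 1) * u z) / exp (2 * (B + 1) * u x)"
    by (simp add: pos_le_divide_eq)
  also have "\<dots> = exp (2 * (B + 1) * (u z - u x))"
    by (simp add: exp_diff[symmetric] algebra_simps)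
  also have "\<dots> \<le> exp (2 * (B + 1) * (2 * K))"
    using K[OF z(1)] K[OF \<open>x \<in> topspace X\<close>] \<open>0 \<le> B\<close> by (intro iffD2[OF exp_le_cancel_iff] mult_left_mono) auto
  also have "\<dots> = (exp (2 * (B + 1) * K))\<^sup>2"
    by (simp add: exp_double[symmetric] algebra_simps)
  finally have "?Q x \<le> (exp (2 * (B + 1) * K))\<^sup>2" by linarith
  then show ?thesis by (rule power2_le_imp_le) simp
qed

end

section \<open>The gradient estimate\<close>

lemma hessian_lower_bound_of_eigenvalues:
  fixes \<A> :: "('m, 'n::{finite,linorder}) chart set"
  assumes "riemannian_atlas X \<A> g" and x: "x \<in> topspace X"
    and B: "symmetric_bilinear \<A> x B"
    and cone: "metric_eigenvalues \<A> g x B + k *\<^sub>R (\<chi> i. 1) \<in> closure (Gamma_cone CARD('n))"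
    and v: "v \<in> tangent_space \<A> x"
  shows "- k * g x v v \<le> B v v"
proof -
  interpret riemannian_atlas X \<A> g by fact
  let ?c = "chart_at \<A> x"
  let ?G = "metric_matrix \<A> g ?c (snd ?c x)"
  let ?W = "tensor_matrix \<A> ?c x B"
  have c: "?c \<in> charts_at \<A> x" by (rule chart_at_in[OF x])
  have "- k \<le> sorted_eigenvalues (matrix_inv ?G ** ?W) $ i" for i
    using closure_Gamma_cone_nonneg[OF cone, of i] by (simp add: metric_eigenvalues_def Let_def)
  from quadratic_form_ge_of_eigenvalues_ge[OF metric_matrix_sym_at[OF c] metric_matrix_pos_at[OF c]
      tensor_matrix_symmetric[OF c B] this]
  show ?thesis
    unfolding metric_components[OF c v v] symmetric_bilinear_expansion[OF c B v v] .
qed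

lemma uniform_bound_on_slab:
  fixes \<phi>3 :: "'m \<times> real \<Rightarrow> real"
  assumes "compact_space X" "continuous_map (prod_topology X euclideanreal) euclideanreal \<phi>3"
  obtains S where "\<And>x t. x \<in> topspace X \<Longrightarrow> \<bar>t\<bar> \<le> K \<Longrightarrow> \<phi>3 (x, t) \<le> S"
proof -
  have "compactin (prod_topology X euclideanreal) (topspace X \<times> {-K..K})"
    using assms(1) by (simp add: compactin_Times compact_space_def)
  then have "compact (\<phi>3 ` (topspace X \<times> {-K..K}))"
    using image_compactin[OF _ assms(2)] by simp
  then have "bdd_above (\<phi>3 ` (topspace X \<times> {-K..K}))"
    by (simp add: bounded_imp_bdd_above compact_imp_bounded)
  then obtain S where "\<And>z. z \<in> topspace X \<times> {-K..K} \<Longrightarrow> \<phi>3 z \<le> S"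
    by (auto simp: bdd_above_def)
  then have "\<phi>3 (x, t) \<le> S" if "x \<in> topspace X" "\<bar>t\<bar> \<le> K" for x t
    using that by (simp add: abs_le_iff)
  then show thesis by (rule that)
qed

theorem theorem7p2:
  fixes X :: "'m topology"
    and \<A> :: "('m, 'n::{finite,linorder}) chart set"
    and g :: "('m, 'n) metric"
    and p :: nat
    and A :: "('m, 'n) covec \<Rightarrow> real \<Rightarrow> ('m, 'n) tvec \<Rightarrow> ('m, 'n) tvec \<Rightarrow> real"
    and \<phi> :: "('m, 'n) covec \<Rightarrow> real \<Rightarrow> real"
    and C :: "real \<Rightarrow> real"
  assumes "smooth_manifold X \<A>"
    and "topspace X \<noteq> {}" and "connected_space X" and "compact_space X"
    and "riemannian_metric X \<A> g"
    and "CARD('n) \<ge> 3"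
    and "p \<in> {2..CARD('n)}"
    and "smooth_bilinear_family X \<A> A"
    and "smooth_scalar \<A> \<phi>"
    and "\<forall>\<alpha>\<in>cotangent_bundle X \<A>. \<forall>t. 0 < \<phi> \<alpha> t"
    and "\<exists>\<phi>3 :: 'm \<times> real \<Rightarrow> real.
           continuous_map (prod_topology X euclideanreal) euclideanreal \<phi>3 \<and>
           (\<forall>x\<in>topspace X. \<forall>t. 0 \<le> \<phi>3 (x, t)) \<and>
           (\<forall>x\<in>topspace X. \<forall>t. \<forall>\<alpha>\<in>cotangent_space \<A> x. \<forall>v\<in>tangent_space \<A> x.
              A \<alpha> t v v \<le> \<phi>3 (x, t) * g x v v * ((covec_norm \<A> g \<alpha>)\<^sup>2 + 1))"
    and "\<forall>K. 0 \<le> C K"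
  shows "\<exists>M :: real \<Rightarrow> real. (\<forall>K. 0 < M K) \<and>
    (\<forall>u. Ck_manifold \<A> 3 u \<longrightarrow>
         general_p_hessian_equation X \<A> g p A \<phi> u \<longrightarrow>
         (\<forall>x\<in>topspace X.
            hessian_eigenvalues \<A> g A u x
              + (C (max_over X (\<lambda>y. \<bar>u y\<bar>)) * ((covec_norm \<A> g (differential \<A> u x))\<^sup>2 + 1)) *\<^sub>R (\<chi> i. 1)
            \<in> closure (Gamma_cone CARD('n))) \<longrightarrow>
         max_over X (\<lambda>x. covec_norm \<A> g (differential \<A> u x)) \<le> M (max_over X (\<lambda>y. \<bar>u y\<bar>)))"
proof -
  interpret riemannian_atlas X \<A> g
    by unfold_locales fact+
  obtain \<phi>3 where \<phi>3: "continuous_map (prod_topology X euclideanreal) euclideanreal \<phi>3"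
    and A_le: "\<And>x t \<alpha> v. x \<in> topspace X \<Longrightarrow> \<alpha> \<in> cotangent_space \<A> x \<Longrightarrow> v \<in> tangent_space \<A> x \<Longrightarrow>
      A \<alpha> t v v \<le> \<phi>3 (x, t) * g x v v * ((covec_norm \<A> g \<alpha>)\<^sup>2 + 1)"
    using assms(11) by blast
  have "\<exists>S. \<forall>x t. x \<in> topspace X \<longrightarrow> \<bar>t\<bar> \<le> K \<longrightarrow> \<phi>3 (x, t) \<le> S" for K
    by (rule uniform_bound_on_slab[OF \<open>compact_space X\<close> \<phi>3, of K]) blast
  then obtain S where S: "\<And>K x t. x \<in> topspace X \<Longrightarrow> \<bar>t\<bar> \<le> K \<Longrightarrow> \<phi>3 (x, t) \<le> S K"
    by metis
  \<comment> \<open>The constant in the bound of the Hessian from below; the maximum with \<open>0\<close> makes it non-negative,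
    as \<open>S K\<close> may have either sign.\<close>
  define B where "B = (\<lambda>K. C K + max 0 (S K))"
  have "0 \<le> B K" for K using assms(12) by (simp add: B_def add_nonneg_nonneg)
  show ?thesis
  proof (intro exI[of _ "\<lambda>K. exp (2 * (B K + 1) * K)"] conjI allI impI)
    fix u
    assume u: "Ck_manifold \<A> 3 u"
    define K where "K = max_over X (\<lambda>y. \<bar>u y\<bar>)"
    assume "\<forall>x\<in>topspace X. hessian_eigenvalues \<A> g A u x
        + (C (max_over X (\<lambda>y. \<bar>u y\<bar>)) * ((covec_norm \<A> g (differential \<A> u x))\<^sup>2 + 1)) *\<^sub>R (\<chi> i. 1)
        \<in> closure (Gamma_cone CARD('n))"
    then have cone: "metric_eigenvalues \<A> g x (\<lambda>v w. A (differential \<A> u x) (u x) v w + hessian \<A> g u x v w)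
        + (C K * ((covec_norm \<A> g (differential \<A> u x))\<^sup>2 + 1)) *\<^sub>R (\<chi> i. 1) \<in> closure (Gamma_cone CARD('n))"
      if "x \<in> topspace X" for x
      using that by (simp add: hessian_eigenvalues_def K_def)
    have "continuous_map X euclideanreal (\<lambda>y. \<bar>u y\<bar>)"
      by (rule continuous_map_real_abs[OF continuous_map_Ck3[OF u]])
    then have "compact ((\<lambda>y. \<bar>u y\<bar>) ` topspace X)"
      using \<open>compact_space X\<close> image_compactin[of X "topspace X" euclideanreal] by (simp add: compact_space_def)
    then have bdd: "bdd_above ((\<lambda>y. \<bar>u y\<bar>) ` topspace X)"
      by (simp add: bounded_imp_bdd_above compact_imp_bounded)
    have K: "\<bar>u x\<bar> \<le> K" if "x \<in> topspace X" for x
      unfolding K_def max_over_def by (rule cSUP_upper[OF that bdd])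
    have hess: "- B K * ((covec_norm \<A> g (differential \<A> u x))\<^sup>2 + 1) * g x v v \<le> hessian \<A> g u x v v"
      if x: "x \<in> topspace X" and v: "v \<in> tangent_space \<A> x" for x v
    proof -
      let ?\<alpha> = "differential \<A> u x"
      let ?N = "(covec_norm \<A> g ?\<alpha>)\<^sup>2 + 1"
      have \<alpha>: "?\<alpha> \<in> cotangent_space \<A> x" by (rule differential_cotangent[OF u x])
      then have "?\<alpha> \<in> cotangent_bundle X \<A>" "fst ?\<alpha> = x"
        using x by (auto simp: cotangent_bundle_def cotangent_space_def)
      then have "symmetric_bilinear \<A> x (A ?\<alpha> (u x))"
        using assms(8) unfolding smooth_bilinear_family_def by metis
      then have bil: "symmetric_bilinear \<A> x (\<lambda>v w. A ?\<alpha> (u x) v w + hessian \<A> g u x v w)"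
        using hessian_bilinear[OF u x]
        by (simp add: symmetric_bilinear_def tangent_linear_def algebra_simps)
      have "- (C K * ?N) * g x v v \<le> A ?\<alpha> (u x) v v + hessian \<A> g u x v v"
        by (rule hessian_lower_bound_of_eigenvalues[OF riemannian_atlas_axioms x bil cone[OF x] v])
      moreover have "A ?\<alpha> (u x) v v \<le> \<phi>3 (x, u x) * (g x v v * ?N)"
        using A_le[OF x \<alpha> v, of "u x"] by (simp add: mult.assoc)
      moreover have "\<phi>3 (x, u x) * (g x v v * ?N) \<le> max 0 (S K) * (g x v v * ?N)"
      proof (rule mult_right_mono)
        show "\<phi>3 (x, u x) \<le> max 0 (S K)" using S[OF x K[OF x]] by simp
        have "0 \<le> g x v v"
          using metric_pos[OF x v] metric_components[OF chart_at_in[OF x] v v]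
          by (cases "v = (\<lambda>_. 0)") auto
        then show "0 \<le> g x v v * ?N" by (intro mult_nonneg_nonneg) auto
      qed
      ultimately show ?thesis by (simp add: B_def algebra_simps)
    qed
    have "covec_norm \<A> g (differential \<A> u x) \<le> exp (2 * (B K + 1) * K)" if "x \<in> topspace X" for x
      by (rule gradient_bound_of_hessian_bound[OF \<open>compact_space X\<close> that u \<open>0 \<le> B K\<close> hess K])
    then show "max_over X (\<lambda>x. covec_norm \<A> g (differential \<A> u x)) \<le>
        exp (2 * (B (max_over X (\<lambda>y. \<bar>u y\<bar>)) + 1) * max_over X (\<lambda>y. \<bar>u y\<bar>))"
      unfolding max_over_def[of X "\<lambda>x. covec_norm \<A> g (differential \<A> u x)"] K_def
      using \<open>topspace X \<noteq> {}\<close> by (intro cSUP_least) auto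
  qed simp
qed

end
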